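(* Let $G$ be a (discrete) group and let $\mu$ be a symmetric non-degenerate probability distribution on $G$. Then $\ell^\infty(G)$ admits a $\mu$-stationary conditional mean if and only if $G$ is amenable.
   Context: A probability distribution $\mu$ on $G$ is symmetric if $\mu(g)=\mu(g^{-1})$ for all $g\in G$, and non-degenerate if its support generates $G$ as a semigroup. $\ell^\infty(G)$ is the space of all bounded real functions on $G$ with the pointwise order. A conditional mean on $\ell^\infty(G)$ is a function $P$ with values in $[0,1]$, defined on all pairs $(f,h)$ of bounded functions with $0\leq f\leq h\neq 0$ (value written $P(f|h)$), such that the following hold whenever defined: (CM1) $P(f_1+f_2|h)=P(f_1|h)+P(f_2|h)$ (for $f_1,f_2\geq 0$, $f_1+f_2\leq h\ne 0$); (CM2) $P(f_1|h)=P(f_1|f_2)\,P(f_2|h)$ (for $0\leq f_1\leq f_2\leq h$, $f_2\neq 0$); (CM3) $P(f|f)=1$ (for $f\geq 0$, $f\neq 0$). For $f\in\ell^\infty(G)$, $\mu*f=\sum_{g\in G}\mu(g)\,gf$ where $(gf)(x)=f(g^{-1}x)$. The conditional mean $P$ is $\mu$-stationary if $P(\mu*f|h)=P(f|h)$ holds whenever both sides are defined, i.e. whenever $0\leq f\leq h\neq 0$ and $\mu*f\leq h$. *)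

theory Defs
  imports "HOL-Probability.Probability" "HOL-Algebra.Group"
begin

text \<open>
  A function on the carrier of \<open>G\<close> is represented by its extension by zero to the whole type, so
  that equality, order and addition of functions on \<open>G\<close> are those of the function type.
\<close>

definition l_infty :: "('a, 'b) monoid_scheme \<Rightarrow> ('a \<Rightarrow> real) set" where
  "l_infty G = {f. bounded (f ` carrier G) \<and> (\<forall>x. x \<notin> carrier G \<longrightarrow> f x = 0)}"

definition left_translate ::
  "('a, 'b) monoid_scheme \<Rightarrow> 'a \<Rightarrow> ('a \<Rightarrow> real) \<Rightarrow> 'a \<Rightarrow> real" where
  "left_translate G g f = (\<lambda>x. if x \<in> carrier G then f (inv\<^bsub>G\<^esub> g \<otimes>\<^bsub>G\<^esub> x) else 0)"

definition convolution ::
  "('a, 'b) monoid_scheme \<Rightarrow> 'a pmf \<Rightarrow> ('a \<Rightarrow> real) \<Rightarrow> 'a \<Rightarrow> real" where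
  "convolution G \<mu> f = (\<lambda>x. \<Sum>\<^sub>\<infinity>g\<in>carrier G. pmf \<mu> g * left_translate G g f x)"

definition symmetric_pmf :: "('a, 'b) monoid_scheme \<Rightarrow> 'a pmf \<Rightarrow> bool" where
  "symmetric_pmf G \<mu> \<longleftrightarrow> (\<forall>g\<in>carrier G. pmf \<mu> g = pmf \<mu> (inv\<^bsub>G\<^esub> g))"

text \<open>Unlike \<open>generate\<close>, this adds neither the unit nor inverses.\<close>

inductive_set semigroup_generate :: "('a, 'b) monoid_scheme \<Rightarrow> 'a set \<Rightarrow> 'a set"
  for G and H where
    incl: "h \<in> H \<Longrightarrow> h \<in> semigroup_generate G H"
  | mult: "h \<in> semigroup_generate G H \<Longrightarrow> k \<in> semigroup_generate G H
      \<Longrightarrow> h \<otimes>\<^bsub>G\<^esub> k \<in> semigroup_generate G H"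

definition nondegenerate_pmf :: "('a, 'b) monoid_scheme \<Rightarrow> 'a pmf \<Rightarrow> bool" where
  "nondegenerate_pmf G \<mu> \<longleftrightarrow> semigroup_generate G (set_pmf \<mu>) = carrier G"

text \<open>
  A conditional mean is a total function \<open>P\<close>, with \<open>P f h\<close> for the value written \<open>P(f|h)\<close>; only
  its values on pairs satisfying \<open>cm_defined\<close> are constrained or used.
\<close>

definition cm_defined ::
  "('a, 'b) monoid_scheme \<Rightarrow> ('a \<Rightarrow> real) \<Rightarrow> ('a \<Rightarrow> real) \<Rightarrow> bool" where
  "cm_defined G f h \<longleftrightarrow>
     f \<in> l_infty G \<and> h \<in> l_infty G \<and> (\<lambda>_. 0) \<le> f \<and> f \<le> h \<and> h \<noteq> (\<lambda>_. 0)"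

definition conditional_mean ::
  "('a, 'b) monoid_scheme \<Rightarrow> (('a \<Rightarrow> real) \<Rightarrow> ('a \<Rightarrow> real) \<Rightarrow> real) \<Rightarrow> bool" where
  "conditional_mean G P \<longleftrightarrow>
     (\<forall>f h. cm_defined G f h \<longrightarrow> P f h \<in> {0..1}) \<and>
     (\<forall>f\<^sub>1 f\<^sub>2 h. cm_defined G f\<^sub>1 h \<and> cm_defined G f\<^sub>2 h \<and> cm_defined G (\<lambda>x. f\<^sub>1 x + f\<^sub>2 x) h
        \<longrightarrow> P (\<lambda>x. f\<^sub>1 x + f\<^sub>2 x) h = P f\<^sub>1 h + P f\<^sub>2 h) \<and>
     (\<forall>f\<^sub>1 f\<^sub>2 h. cm_defined G f\<^sub>1 h \<and> cm_defined G f\<^sub>1 f\<^sub>2 \<and> cm_defined G f\<^sub>2 h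
        \<longrightarrow> P f\<^sub>1 h = P f\<^sub>1 f\<^sub>2 * P f\<^sub>2 h) \<and>
     (\<forall>f. cm_defined G f f \<longrightarrow> P f f = 1)"

definition stationary ::
  "('a, 'b) monoid_scheme \<Rightarrow> 'a pmf \<Rightarrow> (('a \<Rightarrow> real) \<Rightarrow> ('a \<Rightarrow> real) \<Rightarrow> real) \<Rightarrow> bool" where
  "stationary G \<mu> P \<longleftrightarrow>
     (\<forall>f h. cm_defined G f h \<and> cm_defined G (convolution G \<mu> f) h
        \<longrightarrow> P (convolution G \<mu> f) h = P f h)"

definition mean_on :: "('a, 'b) monoid_scheme \<Rightarrow> (('a \<Rightarrow> real) \<Rightarrow> real) \<Rightarrow> bool" where
  "mean_on G m \<longleftrightarrow>
     (\<forall>f\<in>l_infty G. \<forall>h\<in>l_infty G. m (\<lambda>x. f x + h x) = m f + m h) \<and>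
     (\<forall>f\<in>l_infty G. \<forall>c. m (\<lambda>x. c * f x) = c * m f) \<and>
     (\<forall>f\<in>l_infty G. (\<lambda>_. 0) \<le> f \<longrightarrow> 0 \<le> m f) \<and>
     m (indicator (carrier G)) = 1"

definition amenable :: "('a, 'b) monoid_scheme \<Rightarrow> bool" where
  "amenable G \<longleftrightarrow>
     (\<exists>m. mean_on G m \<and> (\<forall>g\<in>carrier G. \<forall>f\<in>l_infty G. m (left_translate G g f) = m f))"

end

theory Submission
  imports Defs
begin

text \<open>
  Write \<open>M f = \<mu> * f\<close> and \<open>heat n = M\<^sup>n \<delta>\<close>, where \<open>\<delta>\<close> is the indicator of the unit.

  If \<open>P\<close> is stationary, then no bounded \<open>h \<ge> 0\<close>, \<open>h \<noteq> 0\<close> satisfies \<open>M h \<le> h / r\<close> with \<open>r > 1\<close>: otherwise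
  \<open>1 = P(M\<^sup>k h | h) \<le> r\<^sup>-\<^sup>k\<close>. Applied to \<open>h = (\<Sum>n. r\<^sup>n heat n)\<close>, this shows that the squared \<open>l\<^sup>2\<close> norm
  of \<open>heat n\<close> does not decay geometrically, so along some subsequence \<open>M\<close> almost preserves the norm of
  \<open>heat n\<close>. The variance inequality then makes all translates of \<open>heat n\<close> by the support of \<open>\<mu>\<close> close
  to \<open>heat (n + 1)\<close>, and an ultralimit of the means weighted by \<open>(heat n)\<^sup>2\<close> takes the same value on all
  these translates of a function; averaging over one step of the walk makes it invariant.

  Conversely, let \<open>m\<close> be an invariant mean. If \<open>u = (\<Sum>n. r\<^sup>n heat n)\<close> were finite for some \<open>r > 1\<close>, then
  \<open>M u \<le> u / r\<close>. The functions \<open>D g x = ln (u (g\<^sup>-\<^sup>1 x)) - ln (u x)\<close> are bounded by Harnack's inequality, and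
  \<open>m (D (g\<^sup>-\<^sup>1)) = - m (D g)\<close>, so by symmetry the \<open>\<mu>\<close>-average of \<open>D\<close> has mean zero, whereas by concavity
  of the logarithm it is at most \<open>- ln r\<close>. Hence the series diverges for every \<open>r > 1\<close>. Therefore the functionals
  \<open>f \<mapsto> (\<Sum>n. tent n * (M\<^sup>n f)(1))\<close>, with a weight that first grows like \<open>r\<^sup>n\<close> and then decays like \<open>r\<^sup>-\<^sup>n\<close>,
  are stationary up to a relative error that vanishes as \<open>r \<rightarrow> 1\<close>, and an ultralimit of their
  quotients is the required conditional mean.
\<close>

section \<open>Ultralimits\<close>

lemma Bseq_plus:
  fixes x y :: "nat \<Rightarrow> real"
  assumes "Bseq x" "Bseq y"
  shows "Bseq (\<lambda>n. x n + y n)"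
proof -
  obtain J K where "\<And>n. norm (x n) \<le> J" "\<And>n. norm (y n) \<le> K"
    using assms by (auto simp: Bseq_def)
  then have "norm (x n + y n) \<le> J + K" for n
    by (rule norm_add_rule_thm)
  then show ?thesis
    by (rule BseqI')
qed

text \<open>The evaluation maps \<open>x \<mapsto> x n\<close> lie in a compact product of
  intervals, so they have a cluster point \<open>L\<close>. Every closed relation satisfied by all
  late evaluations passes to \<open>L\<close>, which gives additivity and the bounds. It also gives
  multiplicativity, on which the product rule for conditional means will rest.\<close>

lemma ultralimit_exists:
  obtains L :: "(nat \<Rightarrow> real) \<Rightarrow> real" where
    "\<And>x y. Bseq x \<Longrightarrow> Bseq y \<Longrightarrow> L (\<lambda>n. x n + y n) = L x + L y"
    "\<And>x y. Bseq x \<Longrightarrow> Bseq y \<Longrightarrow> L (\<lambda>n. x n * y n) = L x * L y"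
    "\<And>x a. Bseq x \<Longrightarrow> (\<And>n. a \<le> x n) \<Longrightarrow> a \<le> L x"
    "\<And>x a. Bseq x \<Longrightarrow> (\<And>n. x n \<le> a) \<Longrightarrow> L x \<le> a"
    "\<And>x l. x \<longlonglongrightarrow> l \<Longrightarrow> L x = l"
proof -
  define b where "b x = (SOME b. \<forall>n. \<bar>x n\<bar> \<le> b)" for x :: "nat \<Rightarrow> real"
  have b: "\<bar>x n\<bar> \<le> b x" if x: "Bseq x" for x n
  proof -
    obtain c where "\<forall>n. \<bar>x n\<bar> \<le> c"
      using x unfolding Bseq_def real_norm_def by blast
    then have "\<forall>n. \<bar>x n\<bar> \<le> b x"
      unfolding b_def by (rule someI)
    then show ?thesis by simp
  qed
  \<comment> \<open>Unbounded sequences get the default value 0, so that the product over all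
    sequences is compact.\<close>
  define B where "B x = (if Bseq x then {- b x..b x} else {0})" for x :: "nat \<Rightarrow> real"
  define e where "e n x = (if Bseq x then x n else 0)" for n and x :: "nat \<Rightarrow> real"
  have "compactin (product_topology (\<lambda>x. euclidean) UNIV) (PiE UNIV B)"
    by (subst compactin_PiE) (auto simp: B_def)
  then have "compact (PiE UNIV B)"
    by (simp add: euclidean_product_topology)
  moreover have "e n \<in> PiE UNIV B" for n
    unfolding PiE_UNIV_domain by (rule Pi_I) (use b in \<open>simp add: B_def e_def abs_le_iff minus_le_iff[of "b _"]\<close>)
  then have "eventually (\<lambda>L. L \<in> PiE UNIV B) (filtermap e sequentially)"
    by (simp add: eventually_filtermap)
  moreover have "filtermap e sequentially \<noteq> bot"
    by (simp add: filtermap_bot_iff)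
  ultimately obtain L where L: "inf (nhds L) (filtermap e sequentially) \<noteq> bot"
    unfolding compact_filter by blast
  \<comment> \<open>Each property of \<open>L\<close> below is an instance of this: in the product
    topology a relation between finitely many coordinates defines a closed set.\<close>
  have closedI: "L \<in> C" if "closed C" "\<forall>\<^sub>F n in sequentially. e n \<in> C" for C
  proof (rule ccontr)
    assume "L \<notin> C"
    then have "eventually (\<lambda>y. y \<in> - C) (nhds L)"
      using that(1) by (intro eventually_nhds_in_open) auto
    moreover have "eventually (\<lambda>y. y \<in> C) (filtermap e sequentially)"
      using that(2) by (simp add: eventually_filtermap)
    ultimately have "eventually (\<lambda>y. False) (inf (nhds L) (filtermap e sequentially))"
      unfolding eventually_inf by (metis (no_types, lifting) ComplD)
    then show False
      using L by (simp add: eventually_False)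
  qed
  have ev: "continuous_on UNIV (\<lambda>L :: (nat \<Rightarrow> real) \<Rightarrow> real. L x)" for x
    by simp
  have lower: "a \<le> L x" if "Bseq x" "\<forall>\<^sub>F n in sequentially. a \<le> x n" for x a
  proof -
    have "L \<in> {L. a \<le> L x}"
      using that by (intro closedI closed_Collect_le ev continuous_on_const) (auto simp: e_def)
    then show ?thesis by simp
  qed
  have upper: "L x \<le> a" if "Bseq x" "\<forall>\<^sub>F n in sequentially. x n \<le> a" for x a
  proof -
    have "L \<in> {L. L x \<le> a}"
      using that by (intro closedI closed_Collect_le ev continuous_on_const) (auto simp: e_def)
    then show ?thesis by simp
  qed
  show thesis
  proof
    show "L (\<lambda>n. x n + y n) = L x + L y" if xy: "Bseq x" "Bseq y" for x y
    proof -
      have "Bseq (\<lambda>n. x n + y n)"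
        using xy by (rule Bseq_plus)
      then have "L \<in> {L. L (\<lambda>n. x n + y n) = L x + L y}"
        using xy
        by (intro closedI closed_Collect_eq ev continuous_on_add) (auto simp: e_def)
      then show ?thesis by simp
    qed
    show "L (\<lambda>n. x n * y n) = L x * L y" if xy: "Bseq x" "Bseq y" for x y
    proof -
      have "Bseq (\<lambda>n. x n * y n)"
        using xy by (rule Bseq_mult)
      then have "L \<in> {L. L (\<lambda>n. x n * y n) = L x * L y}"
        using xy
        by (intro closedI closed_Collect_eq ev continuous_on_mult) (auto simp: e_def)
      then show ?thesis by simp
    qed
    show "a \<le> L x" if "Bseq x" "\<And>n. a \<le> x n" for x a
      using that by (intro lower) auto
    show "L x \<le> a" if "Bseq x" "\<And>n. x n \<le> a" for x a
      using that by (intro upper) auto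
    show "L x = l" if "x \<longlonglongrightarrow> l" for x l
    proof (rule antisym)
      have B: "Bseq x"
        using that by (blast intro: convergentI convergent_imp_Bseq)
      show "L x \<le> l"
      proof (rule dense_ge)
        fix a assume "l < a"
        then show "L x \<le> a"
          using order_tendstoD(2)[OF that \<open>l < a\<close>] by (intro upper B) (auto elim: eventually_mono)
      qed
      show "l \<le> L x"
      proof (rule dense_le)
        fix a assume "a < l"
        then show "a \<le> L x"
          using order_tendstoD(1)[OF that \<open>a < l\<close>] by (intro lower B) (auto elim: eventually_mono)
      qed
    qed
  qed
qed

section \<open>The walk and its Green series\<close>

lemma bounded_image_iff: "bounded (f ` A) \<longleftrightarrow> (\<exists>B. \<forall>x\<in>A. \<bar>f x\<bar> \<le> B)" for f :: "'a \<Rightarrow> real"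
  by (simp add: bounded_iff)

lemma bounded_image_const [simp]: "bounded ((\<lambda>_. c) ` A)" for c :: real
  unfolding bounded_image_iff by blast

lemma bounded_image_power2:
  fixes f :: "'a \<Rightarrow> real"
  assumes "bounded (f ` A)"
  shows "bounded ((\<lambda>x. (f x)\<^sup>2) ` A)"
proof -
  obtain B where "\<forall>x\<in>A. \<bar>f x\<bar> \<le> B"
    using assms unfolding bounded_image_iff by blast
  then have "\<forall>x\<in>A. \<bar>(f x)\<^sup>2\<bar> \<le> B\<^sup>2"
    by (metis abs_ge_zero abs_power2 power2_abs power_mono)
  then show ?thesis
    unfolding bounded_image_iff by blast
qed

lemma bounded_image_cmult: "bounded (f ` A) \<Longrightarrow> bounded ((\<lambda>x. c * f x) ` A)"
  for f :: "'a \<Rightarrow> real"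
  using bounded_scaling[of "f ` A" c] by (simp add: image_image)

lemma real_summable_on_comparison:
  fixes f :: "'a \<Rightarrow> real"
  assumes "g summable_on A" "\<And>x. x \<in> A \<Longrightarrow> \<bar>f x\<bar> \<le> g x"
  shows "f summable_on A"
  by (subst summable_on_iff_abs_summable_on_real, rule Infinite_Sum.abs_summable_on_comparison_test'[OF assms(1)])
    (use assms(2) in simp)

locale symmetric_walk = group +
  fixes \<mu> :: "'a pmf"
  assumes supp: "set_pmf \<mu> \<subseteq> carrier G"
    and symm: "g \<in> carrier G \<Longrightarrow> pmf \<mu> (inv g) = pmf \<mu> g"
    and gen: "semigroup_generate G (set_pmf \<mu>) = carrier G"
begin

section \<open>The convolution operator on bounded functions\<close>

abbreviation bdd :: "('a \<Rightarrow> real) \<Rightarrow> bool" where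
  "bdd f \<equiv> bounded (f ` carrier G)"

abbreviation M :: "('a \<Rightarrow> real) \<Rightarrow> 'a \<Rightarrow> real" where
  "M \<equiv> convolution G \<mu>"

lemma cancel_inv_left [simp]:
  "g \<in> carrier G \<Longrightarrow> x \<in> carrier G \<Longrightarrow> inv g \<otimes> (g \<otimes> x) = x"
  "g \<in> carrier G \<Longrightarrow> x \<in> carrier G \<Longrightarrow> g \<otimes> (inv g \<otimes> x) = x"
  by (simp_all add: m_assoc[symmetric])

lemma M_eq: "x \<in> carrier G \<Longrightarrow> M f x = (\<Sum>\<^sub>\<infinity>g\<in>carrier G. pmf \<mu> g * f (inv g \<otimes> x))"
  by (simp add: convolution_def left_translate_def)

lemma M_outside [simp]: "x \<notin> carrier G \<Longrightarrow> M f x = 0"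
  by (simp add: convolution_def left_translate_def)

lemma pmf_summable: "pmf \<mu> summable_on carrier G"
  using abs_summable_equivalent[of "pmf \<mu>" "carrier G"] by (simp add: pmf_abs_summable)

lemma pmf_infsum: "infsum (pmf \<mu>) (carrier G) = 1"
  using infsetsum_infsum[OF pmf_abs_summable, of \<mu> "carrier G"] infsetsum_pmf_eq_1[OF supp] by simp

lemma M_summable:
  assumes "bdd f" "x \<in> carrier G"
  shows "(\<lambda>g. pmf \<mu> g * f (inv g \<otimes> x)) summable_on carrier G"
proof -
  obtain B where "\<forall>y\<in>carrier G. \<bar>f y\<bar> \<le> B"
    using assms(1) unfolding bounded_image_iff by blast
  then have "\<bar>pmf \<mu> g * f (inv g \<otimes> x)\<bar> \<le> pmf \<mu> g * B" if "g \<in> carrier G" for g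
    using that assms(2) by (auto simp: abs_mult intro!: mult_left_mono)
  then show ?thesis
    by (intro real_summable_on_comparison[OF summable_on_cmult_left[OF pmf_summable]])
qed

lemma M_add: "bdd f \<Longrightarrow> bdd h \<Longrightarrow> M (\<lambda>y. f y + h y) x = M f x + M h x"
  by (cases "x \<in> carrier G") (simp_all add: M_eq distrib_left infsum_add M_summable)

lemma M_cmult: "M (\<lambda>y. c * f y) x = c * M f x"
  by (cases "x \<in> carrier G")
    (simp_all add: M_eq mult.left_commute[of _ c] infsum_cmult_right')

lemma M_const: "x \<in> carrier G \<Longrightarrow> M (\<lambda>_. c) x = c"
  by (simp add: M_eq infsum_cmult_left' pmf_infsum)

lemma M_mono:
  assumes "bdd f" "bdd h" "\<And>y. y \<in> carrier G \<Longrightarrow> f y \<le> h y"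
  shows "M f x \<le> M h x"
  by (cases "x \<in> carrier G")
    (use assms in \<open>auto simp: M_eq intro!: infsum_mono M_summable mult_left_mono\<close>)

lemma M_nonneg: "(\<And>y. y \<in> carrier G \<Longrightarrow> 0 \<le> f y) \<Longrightarrow> 0 \<le> M f x"
  by (cases "x \<in> carrier G") (auto simp: M_eq intro!: infsum_nonneg)

lemma M_abs_le:
  assumes "\<And>y. y \<in> carrier G \<Longrightarrow> \<bar>f y\<bar> \<le> B" "x \<in> carrier G"
  shows "\<bar>M f x\<bar> \<le> B"
proof -
  have f: "bdd f"
    unfolding bounded_image_iff using assms(1) by blast
  have "M f x \<le> M (\<lambda>_. B) x"
    by (rule M_mono[OF f]) (use assms(1) in \<open>auto simp: abs_le_iff\<close>)
  moreover have "M (\<lambda>_. - B) x \<le> M f x"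
    by (rule M_mono[OF _ f]) (use assms(1) in \<open>auto simp: abs_le_iff minus_le_iff[of _ "f _"]\<close>)
  ultimately show ?thesis
    using assms(2) by (simp add: M_const abs_le_iff)
qed

lemma M_bdd: "bdd f \<Longrightarrow> bdd (M f)"
  unfolding bounded_image_iff using M_abs_le by meson

lemma M_l_infty: "f \<in> l_infty G \<Longrightarrow> M f \<in> l_infty G"
  by (simp add: l_infty_def M_bdd)

lemma M_sum:
  assumes "finite I" "\<And>i. i \<in> I \<Longrightarrow> bdd (f i)"
  shows "bdd (\<lambda>y. \<Sum>i\<in>I. f i y) \<and> M (\<lambda>y. \<Sum>i\<in>I. f i y) x = (\<Sum>i\<in>I. M (f i) x)"
  using assms
proof (induction rule: finite_induct)
  case empty
  then show ?case
    using M_cmult[of 0 "\<lambda>_. 0"] by simp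
next
  case (insert i I)
  then show ?case
    by (simp add: M_add bounded_plus_comp)
qed

lemma sum_le_M:
  assumes "bdd f" "\<And>y. y \<in> carrier G \<Longrightarrow> 0 \<le> f y" "x \<in> carrier G" "finite F" "F \<subseteq> carrier G"
  shows "(\<Sum>g\<in>F. pmf \<mu> g * f (inv g \<otimes> x)) \<le> M f x"
  unfolding M_eq[OF assms(3)] using assms M_summable
  by (intro finite_sum_le_infsum) auto

lemma M_le_finite_sums:
  assumes "bdd f" "x \<in> carrier G"
    "\<And>F. finite F \<Longrightarrow> F \<subseteq> carrier G \<Longrightarrow> (\<Sum>g\<in>F. pmf \<mu> g * f (inv g \<otimes> x)) \<le> B"
  shows "M f x \<le> B"
  unfolding M_eq[OF assms(2)] using assms M_summable
  by (intro infsum_le_finite_sums) auto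

lemma le_M:
  assumes "bdd f" "\<And>y. y \<in> carrier G \<Longrightarrow> 0 \<le> f y" "x \<in> carrier G" "g \<in> carrier G"
  shows "pmf \<mu> g * f (inv g \<otimes> x) \<le> M f x"
  using sum_le_M[OF assms(1-3), of "{g}"] assms(4) by simp

section \<open>Iterates, the Harnack inequality and the heat kernel\<close>

lemma iter_bdd: "bdd f \<Longrightarrow> bdd ((M ^^ n) f)"
  by (induction n) (simp_all add: M_bdd)

lemma iter_l_infty: "f \<in> l_infty G \<Longrightarrow> (M ^^ n) f \<in> l_infty G"
  by (induction n) (simp_all add: M_l_infty)

lemma iter_nonneg:
  "(\<And>y. y \<in> carrier G \<Longrightarrow> 0 \<le> f y) \<Longrightarrow> x \<in> carrier G \<Longrightarrow> 0 \<le> (M ^^ n) f x"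
  by (induction n arbitrary: x) (simp_all add: M_nonneg)

lemma iter_add:
  assumes "bdd f" "bdd h"
  shows "(M ^^ n) (\<lambda>y. f y + h y) x = (M ^^ n) f x + (M ^^ n) h x"
proof (induction n arbitrary: x)
  case (Suc n)
  then have "(M ^^ n) (\<lambda>y. f y + h y) = (\<lambda>y. (M ^^ n) f y + (M ^^ n) h y)" by blast
  then show ?case
    by (simp add: M_add iter_bdd assms)
qed simp

lemma iter_cmult: "(M ^^ n) (\<lambda>y. c * f y) x = c * (M ^^ n) f x"
proof (induction n arbitrary: x)
  case (Suc n)
  then have "(M ^^ n) (\<lambda>y. c * f y) = (\<lambda>y. c * (M ^^ n) f y)" by blast
  then show ?case
    by (simp add: M_cmult)
qed simp

lemma iter_mono:
  assumes "bdd f" "bdd h" "\<And>y. y \<in> carrier G \<Longrightarrow> f y \<le> h y" "x \<in> carrier G"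
  shows "(M ^^ n) f x \<le> (M ^^ n) h x"
  using assms(4) by (induction n arbitrary: x) (auto simp: assms iter_bdd intro!: M_mono)

lemma iter_abs_le:
  assumes "\<And>y. y \<in> carrier G \<Longrightarrow> \<bar>f y\<bar> \<le> B" "x \<in> carrier G"
  shows "\<bar>(M ^^ n) f x\<bar> \<le> B"
  using assms(2) by (induction n arbitrary: x) (auto simp: assms(1) M_abs_le)

text \<open>Non-degeneracy enters here. For \<open>g\<close> in the support, a single term of the
  convolution at \<open>g \<otimes> x\<close> already gives the bound with \<open>m = 1\<close> and
  \<open>c = pmf \<mu> g\<close>. For a product of such elements the step counts add up and the
  constants multiply.\<close>

lemma harnack:
  assumes "g \<in> carrier G"
  shows "\<exists>m. \<exists>c>0. \<forall>f x. bdd f \<longrightarrow> (\<forall>y\<in>carrier G. 0 \<le> f y) \<longrightarrow> x \<in> carrier G \<longrightarrow>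
    c * f x \<le> (M ^^ m) f (g \<otimes> x)"
proof -
  define H where "H g m c \<longleftrightarrow> (\<forall>f x. bdd f \<longrightarrow> (\<forall>y\<in>carrier G. 0 \<le> f y) \<longrightarrow> x \<in> carrier G \<longrightarrow>
    c * f x \<le> (M ^^ m) f (g \<otimes> x))" for g m and c :: real
  have "g \<in> carrier G \<and> (\<exists>m. \<exists>c>0. H g m c)"
    using assms[folded gen]
  proof (induction rule: semigroup_generate.induct)
    case (incl g)
    then have g: "g \<in> carrier G" using supp by blast
    have "pmf \<mu> g * f x \<le> (M ^^ 1) f (g \<otimes> x)"
      if "bdd f" "\<forall>y\<in>carrier G. 0 \<le> f y" "x \<in> carrier G" for f x
      using le_M[of f "g \<otimes> x" g] that g by simp
    then have "H g 1 (pmf \<mu> g)"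
      unfolding H_def by blast
    then show ?case
      using g pmf_positive[OF incl] by blast
  next
    case (mult g h)
    then obtain m c m' c' where gh: "g \<in> carrier G" "h \<in> carrier G" and c: "c > 0" "c' > 0"
      and H: "H g m c" "H h m' c'"
      by blast
    have "(c * c') * f x \<le> (M ^^ (m + m')) f (g \<otimes> h \<otimes> x)"
      if f: "bdd f" "\<forall>y\<in>carrier G. 0 \<le> f y" "x \<in> carrier G" for f x
    proof -
      have "c * (c' * f x) \<le> c * (M ^^ m') f (h \<otimes> x)"
        using H(2) f c(1) by (simp add: H_def)
      also have "\<dots> \<le> (M ^^ m) ((M ^^ m') f) (g \<otimes> (h \<otimes> x))"
        using H(1) f gh iter_bdd[OF f(1)] iter_nonneg[of f] by (simp add: H_def)
      finally show ?thesis
        using gh f(3) by (simp add: funpow_add m_assoc)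
    qed
    then have "H (g \<otimes> h) (m + m') (c * c')"
      unfolding H_def by blast
    moreover have "c * c' > 0" using c by simp
    ultimately show ?case
      using gh by blast
  qed
  then show ?thesis
    unfolding H_def by blast
qed

text \<open>This is the \<open>n\<close>-th convolution power of \<open>\<mu>\<close>: the
  distribution after \<open>n\<close> steps of the random walk started at the unit.\<close>

definition heat :: "nat \<Rightarrow> 'a \<Rightarrow> real" where
  "heat n = (M ^^ n) (indicator {\<one>})"

lemma indicator_one_l_infty: "indicator {\<one>} \<in> l_infty G"
  by (auto simp: l_infty_def bounded_image_iff indicator_def intro!: exI[of _ 1])

lemma heat_l_infty: "heat n \<in> l_infty G"
  by (simp add: heat_def iter_l_infty indicator_one_l_infty)

lemma l_infty_bdd: "f \<in> l_infty G \<Longrightarrow> bdd f"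
  by (simp add: l_infty_def)

lemmas heat_bdd = heat_l_infty[THEN l_infty_bdd]

lemma heat_0: "heat 0 = indicator {\<one>}"
  by (simp add: heat_def)

lemma heat_Suc: "heat (Suc n) = M (heat n)"
  by (simp add: heat_def)

lemma heat_add: "heat (m + n) = (M ^^ m) (heat n)"
  by (simp add: heat_def funpow_add)

lemma heat_nonneg: "0 \<le> heat n x"
proof (cases "x \<in> carrier G")
  case True
  then show ?thesis
    unfolding heat_def by (intro iter_nonneg) auto
next
  case False
  then show ?thesis
    using heat_l_infty[of n] by (simp add: l_infty_def)
qed

text \<open>The point is uniformity in \<open>n\<close>: with \<open>m\<close> and \<open>c\<close>
  fixed, the inequality can be summed against powers of \<open>r\<close>.\<close>

lemma harnack_heat:
  assumes "g \<in> carrier G"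
  shows "\<exists>m. \<exists>c>0. \<forall>n. \<forall>x\<in>carrier G. c * heat n x \<le> heat (n + m) (g \<otimes> x)"
proof -
  obtain m c where c: "c > 0" and
    H: "\<forall>f x. bdd f \<longrightarrow> (\<forall>y\<in>carrier G. 0 \<le> f y) \<longrightarrow> x \<in> carrier G \<longrightarrow>
      c * f x \<le> (M ^^ m) f (g \<otimes> x)"
    using harnack[OF assms] by blast
  have "c * heat n x \<le> heat (n + m) (g \<otimes> x)" if "x \<in> carrier G" for n x
    using H[rule_format, of "heat n" x] that by (simp add: heat_bdd heat_nonneg heat_add[symmetric] add.commute)
  then show ?thesis
    using c by blast
qed

text \<open>Convolving the Green series shifts its index by one, so dividing by \<open>r\<close>
  restores the series up to its nonnegative first term. The statement uses finite partial sums of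
  the convolution because the Green function is not assumed bounded.\<close>

lemma green_superharmonic:
  assumes "r > 0" "\<And>x. x \<in> carrier G \<Longrightarrow> summable (\<lambda>n. r ^ n * heat n x)"
    and "finite F" "F \<subseteq> carrier G" "x \<in> carrier G"
  shows "(\<Sum>g\<in>F. pmf \<mu> g * (\<Sum>n. r ^ n * heat n (inv g \<otimes> x))) \<le> (\<Sum>n. r ^ n * heat n x) / r"
proof -
  have su: "summable (\<lambda>n. pmf \<mu> g * (r ^ n * heat n (inv g \<otimes> x)))" if "g \<in> F" for g
    using that assms by (intro summable_mult) auto
  have tail: "summable (\<lambda>n. r ^ Suc n * heat (Suc n) x)"
    using assms(2)[OF assms(5)] summable_Suc_iff[of "\<lambda>n. r ^ n * heat n x"] by simp
  then have tail': "summable (\<lambda>n. r ^ n * heat (Suc n) x)"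
    using summable_mult[OF tail, of "1 / r"] assms(1) by (simp add: mult.assoc[symmetric])
  have "(\<Sum>g\<in>F. pmf \<mu> g * (\<Sum>n. r ^ n * heat n (inv g \<otimes> x)))
      = (\<Sum>g\<in>F. \<Sum>n. pmf \<mu> g * (r ^ n * heat n (inv g \<otimes> x)))"
    using assms by (intro sum.cong refl suminf_mult[symmetric]) auto
  also have "\<dots> = (\<Sum>n. \<Sum>g\<in>F. pmf \<mu> g * (r ^ n * heat n (inv g \<otimes> x)))"
    using su by (intro suminf_sum[symmetric]) auto
  also have "\<dots> \<le> (\<Sum>n. r ^ n * heat (Suc n) x)"
  proof (intro suminf_le summable_sum su tail')
    fix n
    have "(\<Sum>g\<in>F. pmf \<mu> g * heat n (inv g \<otimes> x)) \<le> heat (Suc n) x"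
      unfolding heat_Suc using assms by (intro sum_le_M heat_bdd heat_nonneg) auto
    then have "r ^ n * (\<Sum>g\<in>F. pmf \<mu> g * heat n (inv g \<otimes> x)) \<le> r ^ n * heat (Suc n) x"
      using assms(1) by simp
    then show "(\<Sum>g\<in>F. pmf \<mu> g * (r ^ n * heat n (inv g \<otimes> x))) \<le> r ^ n * heat (Suc n) x"
      by (simp add: sum_distrib_left mult.left_commute)
  qed
  also have "\<dots> = (\<Sum>n. r ^ Suc n * heat (Suc n) x) / r"
    using suminf_divide[OF tail, of r] assms(1) by simp
  also have "\<dots> \<le> (\<Sum>n. r ^ n * heat n x) / r"
    using suminf_split_head[OF assms(2)[OF assms(5)]] assms(1) heat_nonneg[of 0 x]
    by (intro divide_right_mono) auto
  finally show ?thesis .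
qed

end

section \<open>From stationarity to slow decay\<close>

text \<open>A Cauchy-Schwarz estimate in the form of a weighted AM-GM inequality:
  \<open>|u\<^sup>2 - v\<^sup>2| = |u - v| |u + v|\<close> is at most
  \<open>(u - v)\<^sup>2 / (2 t) + t (u + v)\<^sup>2 / 2\<close>, and
  \<open>(u + v)\<^sup>2 \<le> 2 (u\<^sup>2 + v\<^sup>2)\<close>. The free parameter
  \<open>t\<close> will balance the two terms.\<close>

lemma square_weights_close:
  fixes u v f :: "'a \<Rightarrow> real"
  assumes u: "(\<lambda>x. (u x)\<^sup>2) summable_on A" and v: "(\<lambda>x. (v x)\<^sup>2) summable_on A"
    and f: "\<And>x. x \<in> A \<Longrightarrow> \<bar>f x\<bar> \<le> B" and t: "t > 0"
  shows "\<bar>(\<Sum>\<^sub>\<infinity>x\<in>A. f x * (u x)\<^sup>2) - (\<Sum>\<^sub>\<infinity>x\<in>A. f x * (v x)\<^sup>2)\<bar>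
    \<le> B * ((\<Sum>\<^sub>\<infinity>x\<in>A. (u x - v x)\<^sup>2) / (2 * t) + t * ((\<Sum>\<^sub>\<infinity>x\<in>A. (u x)\<^sup>2) + (\<Sum>\<^sub>\<infinity>x\<in>A. (v x)\<^sup>2)))"
proof -
  have d: "(\<lambda>x. (u x - v x)\<^sup>2) summable_on A"
  proof (rule real_summable_on_comparison)
    show "(\<lambda>x. 2 * (u x)\<^sup>2 + 2 * (v x)\<^sup>2) summable_on A"
      by (intro summable_on_add summable_on_cmult_right u v)
    show "\<bar>(u x - v x)\<^sup>2\<bar> \<le> 2 * (u x)\<^sup>2 + 2 * (v x)\<^sup>2" for x
      using zero_le_power2[of "u x + v x"] unfolding abs_power2
      by (simp add: power2_eq_square algebra_simps)
  qed
  have w: "(\<lambda>x. f x * w x) summable_on A" if "w summable_on A" "\<And>x. 0 \<le> w x" for w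
  proof (rule real_summable_on_comparison)
    show "(\<lambda>x. B * w x) summable_on A"
      by (intro summable_on_cmult_right that)
    show "\<bar>f x * w x\<bar> \<le> B * w x" if "x \<in> A" for x
      using f[OF that] \<open>0 \<le> w x\<close> by (simp add: abs_mult mult_right_mono)
  qed
  define T where "T x = (u x - v x)\<^sup>2 / (2 * t) + t * ((u x)\<^sup>2 + (v x)\<^sup>2)" for x
  have T: "T summable_on A"
    unfolding T_def divide_inverse
    by (intro summable_on_add summable_on_cmult_right summable_on_cmult_left d u v)
  have "infsum T A = (\<Sum>\<^sub>\<infinity>x\<in>A. (u x - v x)\<^sup>2) / (2 * t) + t * ((\<Sum>\<^sub>\<infinity>x\<in>A. (u x)\<^sup>2) + (\<Sum>\<^sub>\<infinity>x\<in>A. (v x)\<^sup>2))"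
    unfolding T_def divide_inverse
    by (simp add: infsum_add summable_on_add summable_on_cmult_right summable_on_cmult_left d u v
        infsum_cmult_left' infsum_cmult_right' del: inverse_mult_distrib)
  moreover have "\<bar>(\<Sum>\<^sub>\<infinity>x\<in>A. f x * (u x)\<^sup>2) - (\<Sum>\<^sub>\<infinity>x\<in>A. f x * (v x)\<^sup>2)\<bar> \<le> (\<Sum>\<^sub>\<infinity>x\<in>A. B * T x)"
  proof -
    have "norm ((\<Sum>\<^sub>\<infinity>x\<in>A. f x * (u x)\<^sup>2) + - (\<Sum>\<^sub>\<infinity>x\<in>A. f x * (v x)\<^sup>2)) \<le> (\<Sum>\<^sub>\<infinity>x\<in>A. B * T x)"
    proof (rule norm_infsum_le)
      show "((\<lambda>x. f x * (u x)\<^sup>2 + - (f x * (v x)\<^sup>2)) has_sum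
          ((\<Sum>\<^sub>\<infinity>x\<in>A. f x * (u x)\<^sup>2) + - (\<Sum>\<^sub>\<infinity>x\<in>A. f x * (v x)\<^sup>2))) A"
        by (intro has_sum_add has_sum_uminusI has_sum_infsum w u v) auto
      show "((\<lambda>x. B * T x) has_sum (\<Sum>\<^sub>\<infinity>x\<in>A. B * T x)) A"
        by (intro has_sum_infsum summable_on_cmult_right T)
      fix x assume x: "x \<in> A"
      have "0 \<le> (\<bar>u x - v x\<bar> - t * \<bar>u x + v x\<bar>)\<^sup>2"
        by simp
      also have "\<dots> = (u x - v x)\<^sup>2 + t\<^sup>2 * (u x + v x)\<^sup>2 - 2 * t * \<bar>(u x)\<^sup>2 - (v x)\<^sup>2\<bar>"
        by (simp add: power2_diff power_mult_distrib abs_mult[symmetric])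
          (simp add: power2_eq_square algebra_simps)
      finally have "2 * t * \<bar>(u x)\<^sup>2 - (v x)\<^sup>2\<bar> \<le> (u x - v x)\<^sup>2 + t\<^sup>2 * (u x + v x)\<^sup>2"
        by simp
      also have "\<dots> \<le> (u x - v x)\<^sup>2 + t\<^sup>2 * (2 * ((u x)\<^sup>2 + (v x)\<^sup>2))"
        using zero_le_power2[of "u x - v x"]
        by (intro add_left_mono mult_left_mono) (simp_all add: power2_eq_square algebra_simps)
      also have "\<dots> = 2 * t * T x"
        using t by (simp add: T_def field_simps power2_eq_square)
      finally have "\<bar>(u x)\<^sup>2 - (v x)\<^sup>2\<bar> \<le> T x"
        using t by simp
      then have "\<bar>f x\<bar> * \<bar>(u x)\<^sup>2 - (v x)\<^sup>2\<bar> \<le> B * T x"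
        using f[OF x] by (intro mult_mono) auto
      then show "norm (f x * (u x)\<^sup>2 + - (f x * (v x)\<^sup>2)) \<le> B * T x"
        by (simp add: abs_mult right_diff_distrib[symmetric])
    qed
    then show ?thesis
      by simp
  qed
  ultimately show ?thesis
    by (simp add: infsum_cmult_right')
qed

section \<open>Stationary conditional means exclude contraction\<close>

lemma conditional_mean_add:
  assumes "conditional_mean G P"
    "cm_defined G f\<^sub>1 h" "cm_defined G f\<^sub>2 h" "cm_defined G (\<lambda>x. f\<^sub>1 x + f\<^sub>2 x) h"
  shows "P (\<lambda>x. f\<^sub>1 x + f\<^sub>2 x) h = P f\<^sub>1 h + P f\<^sub>2 h"
  using assms(1)[unfolded conditional_mean_def, THEN conjunct2, THEN conjunct1,
      THEN spec[of _ f\<^sub>1], THEN spec[of _ f\<^sub>2], THEN spec[of _ h]] assms(2-4)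
  by simp

lemma conditional_mean_nonneg: "conditional_mean G P \<Longrightarrow> cm_defined G f h \<Longrightarrow> 0 \<le> P f h"
  using conjunct1[OF conditional_mean_def[THEN iffD1], of G P, THEN spec[of _ f], THEN spec[of _ h]]
  by simp

lemma conditional_mean_self: "conditional_mean G P \<Longrightarrow> cm_defined G f f \<Longrightarrow> P f f = 1"
  unfolding conditional_mean_def by (elim conjE allE[of _ f] mp)

lemma stationaryD:
  "stationary G \<mu> P \<Longrightarrow> cm_defined G f h \<Longrightarrow> cm_defined G (convolution G \<mu> f) h \<Longrightarrow>
    P (convolution G \<mu> f) h = P f h"
  unfolding stationary_def by blast

context symmetric_walk
begin

text \<open>Stationarity keeps \<open>P ((M ^^ k) h) h\<close> equal to 1 for all \<open>k\<close>,
  while the iterates shrink below \<open>h / 2\<close>, a function of conditional mean 1/2.\<close>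

lemma stationary_no_contraction:
  assumes P: "conditional_mean G P" "stationary G \<mu> P"
    and h: "h \<in> l_infty G" "\<And>x. 0 \<le> h x" "h \<noteq> (\<lambda>_. 0)"
    and r: "r > 1" "\<And>x. x \<in> carrier G \<Longrightarrow> M h x \<le> h x / r"
  shows False
proof -
  have out: "f x = 0" if "f \<in> l_infty G" "x \<notin> carrier G" for f x
    using that by (simp add: l_infty_def)
  have hb: "bdd h"
    by (rule l_infty_bdd[OF h(1)])
  have iter: "(M ^^ k) h x \<le> h x / r ^ k" for k x
  proof (induction k arbitrary: x)
    case (Suc k)
    show ?case
    proof (cases "x \<in> carrier G")
      case True
      have "M ((M ^^ k) h) x \<le> M (\<lambda>y. (1 / r ^ k) * h y) x"
        by (rule M_mono[OF iter_bdd[OF hb] bounded_image_cmult[OF hb]]) (simp add: Suc)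
      also have "\<dots> = (1 / r ^ k) * M h x"
        by (rule M_cmult)
      also have "\<dots> \<le> (1 / r ^ k) * (h x / r)"
        using r True by (intro mult_left_mono) auto
      finally show ?thesis by (simp add: mult.commute)
    next
      case False
      then show ?thesis by (simp add: out[OF h(1)])
    qed
  qed simp
  have nonneg: "0 \<le> (M ^^ k) h x" for k x
    using iter_nonneg[of h x k] h(2) out[OF iter_l_infty[OF h(1)], of x k] by (cases "x \<in> carrier G") simp_all
  \<comment> \<open>Stationarity speaks only of pairs on which \<open>P\<close> is defined, so every
    iterate has to lie below \<open>h\<close>.\<close>
  have def: "cm_defined G ((M ^^ k) h) h" for k
  proof -
    have "h x / r ^ k \<le> h x" for x
      using divide_left_mono[of 1 "r ^ k" "h x"] h(2)[of x] r(1) by simp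
    then have "(M ^^ k) h x \<le> h x" for x
      using iter order_trans by blast
    then show ?thesis
      unfolding cm_defined_def le_fun_def using nonneg h(1,3) iter_l_infty[OF h(1)] by blast
  qed
  have one: "P ((M ^^ k) h) h = 1" for k
  proof (induction k)
    case 0
    then show ?case
      using conditional_mean_self[OF P(1)] def[of 0] unfolding funpow_0 .
  next
    case (Suc k)
    then show ?case
      using stationaryD[OF P(2), of "(M ^^ k) h" h] def[of k] def[of "Suc k"] by simp
  qed
  \<comment> \<open>Additivity of \<open>P\<close> does not directly give scaling by real factors.
    Comparing with \<open>e = h / 2\<close> suffices, since \<open>e + e = h\<close> determines
    \<open>P e h\<close>; this is where the threshold 2 comes from.\<close>
  obtain k where k: "2 < r ^ k"
    using real_arch_pow[OF r(1)] by blast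
  define f where "f = (M ^^ k) h"
  define e where "e = (\<lambda>x. h x / 2)"
  have fe: "f x \<le> e x" for x
  proof -
    have "f x \<le> h x / r ^ k"
      unfolding f_def by (rule iter)
    also have "\<dots> \<le> h x / 2"
      using k h(2)[of x] by (intro divide_left_mono) auto
    finally show ?thesis by (simp add: e_def)
  qed
  have e: "e \<in> l_infty G"
    using h(1) bounded_image_cmult[of h "carrier G" "1/2"] by (auto simp: l_infty_def e_def)
  have f: "f \<in> l_infty G"
    using h(1) by (simp add: f_def iter_l_infty)
  have ef: "(\<lambda>x. e x - f x) \<in> l_infty G"
    using e f by (simp add: l_infty_def bounded_minus_comp)
  have d1: "cm_defined G e h"
    unfolding cm_defined_def le_fun_def using e h by (simp add: e_def)
  have d3: "cm_defined G f h" "cm_defined G h h"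
    using def[of k] def[of 0] by (simp_all add: f_def)
  have d2: "cm_defined G (\<lambda>x. e x - f x) h"
    unfolding cm_defined_def le_fun_def
  proof (intro conjI allI)
    show "e x - f x \<le> h x" for x
      using nonneg[of k x] h(2)[of x] by (simp add: e_def f_def)
  qed (use ef h fe in auto)
  have add: "P (\<lambda>x. f\<^sub>1 x + f\<^sub>2 x) h = P f\<^sub>1 h + P f\<^sub>2 h"
    if "cm_defined G f\<^sub>1 h" "cm_defined G f\<^sub>2 h" "cm_defined G (\<lambda>x. f\<^sub>1 x + f\<^sub>2 x) h" for f\<^sub>1 f\<^sub>2
    using P(1) that by (rule conditional_mean_add)
  have ee: "(\<lambda>x. e x + e x) = h" "(\<lambda>x. f x + (e x - f x)) = e"
    by (simp_all add: e_def fun_eq_iff)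
  have "P h h = P e h + P e h"
    using add[of e e] d1 d3(2) unfolding ee by blast
  moreover have "P e h = P f h + P (\<lambda>x. e x - f x) h"
    using add[of f "\<lambda>x. e x - f x"] d1 d2 d3(1) unfolding ee by blast
  moreover have "0 \<le> P (\<lambda>x. e x - f x) h"
    using P(1) d2 by (rule conditional_mean_nonneg)
  ultimately show False
    using one[of k] one[of 0] unfolding f_def[symmetric] funpow_0 by linarith
qed

text \<open>Averaging over translates does not increase the total mass of a nonnegative function.
  Taking \<open>X\<close> finite avoids exchanging two infinite sums; the inner sums are bounded by
  the total mass because \<open>x \<mapsto> y \<otimes> x\<close> is injective.\<close>

lemma sum_M_le_infsum:
  assumes f: "bdd f" "\<And>y. y \<in> carrier G \<Longrightarrow> 0 \<le> f y" "f summable_on carrier G"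
    and X: "finite X" "X \<subseteq> carrier G"
  shows "(\<Sum>x\<in>X. M f x) \<le> infsum f (carrier G)"
proof -
  have b: "bdd (\<lambda>y. f (y \<otimes> x))" if "x \<in> X" for x
    using f(1) that X unfolding bounded_image_iff by (meson m_closed subsetD)
  \<comment> \<open>Right translations commute with \<open>M\<close>, so the sum over \<open>X\<close> can be moved inside \<open>M\<close>.\<close>
  have "M f x = M (\<lambda>y. f (y \<otimes> x)) \<one>" if "x \<in> X" for x
    using that X by (simp add: M_eq subset_iff cong: infsum_cong)
  then have "(\<Sum>x\<in>X. M f x) = M (\<lambda>y. \<Sum>x\<in>X. f (y \<otimes> x)) \<one>"
    using M_sum[OF X(1), of "\<lambda>x y. f (y \<otimes> x)"] b by simp
  also have "\<dots> \<le> M (\<lambda>_. infsum f (carrier G)) \<one>"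
  proof (rule M_mono)
    show "bdd (\<lambda>y. \<Sum>x\<in>X. f (y \<otimes> x))"
      using M_sum[OF X(1), of "\<lambda>x y. f (y \<otimes> x)"] b by blast
    fix y assume y: "y \<in> carrier G"
    have "inj_on (\<lambda>x. y \<otimes> x) X"
      using y X by (auto simp: inj_on_def subset_iff)
    then have "(\<Sum>x\<in>X. f (y \<otimes> x)) = sum f ((\<lambda>x. y \<otimes> x) ` X)"
      by (simp add: sum.reindex)
    also have "\<dots> \<le> infsum f (carrier G)"
      using f X y by (intro finite_sum_le_infsum) auto
    finally show "(\<Sum>x\<in>X. f (y \<otimes> x)) \<le> infsum f (carrier G)" .
  qed simp
  finally show ?thesis
    by (simp add: M_const)
qed

text \<open>With \<open>c = M f x\<close>, the variance of \<open>f\<close> after one step from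
  \<open>x\<close> is \<open>M (f - c)\<^sup>2 = M f\<^sup>2 - c\<^sup>2\<close>. Only the
  contribution of \<open>g\<close> to it is kept.\<close>

lemma variance_bound:
  assumes "bdd f" "x \<in> carrier G" "g \<in> carrier G"
  shows "pmf \<mu> g * (f (inv g \<otimes> x) - M f x)\<^sup>2 + (M f x)\<^sup>2 \<le> M (\<lambda>y. (f y)\<^sup>2) x"
proof -
  define c where "c = M f x"
  have b: "bdd (\<lambda>y. (- 2 * c) * f y + c\<^sup>2)" "bdd (\<lambda>y. (f y)\<^sup>2)" "bdd (\<lambda>y. (- 2 * c) * f y)"
    by (intro bounded_plus_comp bounded_image_cmult bounded_image_power2 bounded_image_const assms(1))+
  have eq: "(\<lambda>y. (f y - c)\<^sup>2) = (\<lambda>y. (f y)\<^sup>2 + ((- 2 * c) * f y + c\<^sup>2))"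
    by (simp add: power2_diff fun_eq_iff algebra_simps)
  have "pmf \<mu> g * (f (inv g \<otimes> x) - c)\<^sup>2 \<le> M (\<lambda>y. (f y - c)\<^sup>2) x"
  proof (rule le_M[of "\<lambda>y. (f y - c)\<^sup>2"])
    show "bdd (\<lambda>y. (f y - c)\<^sup>2)"
      unfolding eq by (intro bounded_plus_comp b)
  qed (use assms in auto)
  also have "\<dots> = M (\<lambda>y. (f y)\<^sup>2) x + ((- 2 * c) * c + c\<^sup>2)"
    unfolding eq M_add[OF b(2,1)] M_add[OF b(3) bounded_image_const] M_cmult M_const[OF assms(2)]
    by (simp add: c_def)
  finally show ?thesis
    by (simp add: c_def power2_eq_square)
qed

section \<open>Energy of the heat kernel and its loss in one step\<close>

definition heat_energy :: "nat \<Rightarrow> real" where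
  "heat_energy n = (\<Sum>\<^sub>\<infinity>x\<in>carrier G. (heat n x)\<^sup>2)"

text \<open>The variance bound is summed over \<open>X\<close>, and the mass of
  \<open>(heat n)\<^sup>2\<close> does not grow under \<open>M\<close>. The sums are finite because
  this estimate is itself the source of square summability of \<open>heat (Suc n)\<close>.\<close>

lemma energy_drop_finite:
  assumes "(\<lambda>x. (heat n x)\<^sup>2) summable_on carrier G" "g \<in> carrier G"
  shows "finite X \<Longrightarrow> X \<subseteq> carrier G \<Longrightarrow>
    (\<Sum>x\<in>X. pmf \<mu> g * (heat n (inv g \<otimes> x) - heat (Suc n) x)\<^sup>2 + (heat (Suc n) x)\<^sup>2) \<le> heat_energy n"
  unfolding heat_energy_def heat_Suc using assms
  by (intro order.trans[OF sum_mono sum_M_le_infsum] variance_bound heat_bdd bounded_image_power2) auto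

lemma heat_square_summable: "(\<lambda>x. (heat n x)\<^sup>2) summable_on carrier G"
proof (induction n)
  case 0
  have "(\<lambda>x. (heat 0 x)\<^sup>2) summable_on {\<one>}"
    by simp
  then show ?case
    by (rule summable_on_cong_neutral[THEN iffD1, rotated -1]) (auto simp: heat_0)
next
  case (Suc n)
  show ?case
  proof (rule nonneg_bdd_above_summable_on)
    \<comment> \<open>Any element of the group would serve as \<open>g\<close> here, as its variance
      term is simply dropped; the unit is chosen.\<close>
    have "(\<Sum>x\<in>X. (heat (Suc n) x)\<^sup>2) \<le> heat_energy n" if X: "finite X" "X \<subseteq> carrier G" for X
      using sum_mono[of X "\<lambda>x. (heat (Suc n) x)\<^sup>2"
          "\<lambda>x. pmf \<mu> \<one> * (heat n (inv \<one> \<otimes> x) - heat (Suc n) x)\<^sup>2 + (heat (Suc n) x)\<^sup>2"]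
        energy_drop_finite[OF Suc one_closed X]
      by simp
    then show "bdd_above (sum (\<lambda>x. (heat (Suc n) x)\<^sup>2) ` {F. F \<subseteq> carrier G \<and> finite F})"
      by (intro bdd_aboveI2[of _ _ "heat_energy n"]) auto
  qed simp
qed

lemma heat_energy_0: "heat_energy 0 = 1"
proof -
  have "heat_energy 0 = (\<Sum>\<^sub>\<infinity>x\<in>{\<one>}. (heat 0 x)\<^sup>2)"
    unfolding heat_energy_def by (rule infsum_cong_neutral) (auto simp: heat_0)
  then show ?thesis
    by (simp add: heat_0)
qed

lemma heat_square_le_energy: "x \<in> carrier G \<Longrightarrow> (heat n x)\<^sup>2 \<le> heat_energy n"
  unfolding heat_energy_def using finite_sum_le_infsum[OF heat_square_summable[of n], of "{x}"] by simp

lemma heat_energy_nonneg: "0 \<le> heat_energy n"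
  unfolding heat_energy_def by (simp add: infsum_nonneg)

text \<open>The energy lost in one step controls the \<open>l\<^sup>2\<close> distance between a
  translate of \<open>heat n\<close> and \<open>heat (Suc n)\<close>. A small relative loss
  therefore means near invariance.\<close>

lemma energy_drop:
  assumes "g \<in> set_pmf \<mu>"
  shows "pmf \<mu> g * (\<Sum>\<^sub>\<infinity>x\<in>carrier G. (heat n (inv g \<otimes> x) - heat (Suc n) x)\<^sup>2) + heat_energy (Suc n) \<le> heat_energy n"
proof -
  have g: "g \<in> carrier G" using assms supp by blast
  define D where "D x = pmf \<mu> g * (heat n (inv g \<otimes> x) - heat (Suc n) x)\<^sup>2" for x
  note sum = energy_drop_finite[OF heat_square_summable[of n] g, folded D_def]
  have total: "(\<lambda>x. D x + (heat (Suc n) x)\<^sup>2) summable_on carrier G"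
  proof (rule nonneg_bdd_above_summable_on)
    show "bdd_above (sum (\<lambda>x. D x + (heat (Suc n) x)\<^sup>2) ` {F. F \<subseteq> carrier G \<and> finite F})"
      using sum by (intro bdd_aboveI2[of _ _ "heat_energy n"]) auto
  qed (simp add: D_def)
  then have "(\<Sum>\<^sub>\<infinity>x\<in>carrier G. D x + (heat (Suc n) x)\<^sup>2) \<le> heat_energy n"
    using sum by (intro infsum_le_finite_sums) auto
  moreover have "D summable_on carrier G"
    by (rule real_summable_on_comparison[OF total]) (simp add: D_def)
  ultimately show ?thesis
    by (simp add: infsum_add heat_square_summable heat_energy_def[of "Suc n"])
      (simp add: D_def infsum_cmult_right')
qed

lemma heat_energy_antimono: "heat_energy (Suc n) \<le> heat_energy n"
proof -
  obtain g where g: "g \<in> set_pmf \<mu>"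
    using set_pmf_not_empty[of \<mu>] by blast
  have "0 \<le> pmf \<mu> g * (\<Sum>\<^sub>\<infinity>x\<in>carrier G. (heat n (inv g \<otimes> x) - heat (Suc n) x)\<^sup>2)"
    by (simp add: infsum_nonneg)
  then show ?thesis
    using energy_drop[OF g, of n] by linarith
qed

text \<open>Otherwise the energy decays geometrically, hence so does the supremum of
  \<open>heat n\<close>. A Green series with ratio above 1 then converges to a bounded function that
  \<open>M\<close> contracts.\<close>

lemma stationary_imp_slow_decay:
  assumes P: "conditional_mean G P" "stationary G \<mu> P" and \<rho>: "0 < \<rho>" "\<rho> < 1"
  shows "\<exists>n. \<rho> * heat_energy n < heat_energy (Suc n)"
proof (rule ccontr)
  assume "\<not> ?thesis"
  then have le: "heat_energy (Suc n) \<le> \<rho> * heat_energy n" for n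
    by (meson not_le)
  have heat_energy: "heat_energy n \<le> \<rho> ^ n" for n
  proof (induction n)
    case (Suc n)
    then have "\<rho> * heat_energy n \<le> \<rho> * \<rho> ^ n"
      using \<rho> by simp
    then show ?case
      using le[of n] by simp
  qed (simp add: heat_energy_0)
  \<comment> \<open>One square root passes from energies to the pointwise bound
    \<open>heat n x \<le> (s\<^sup>2) ^ n\<close>. The second leaves room for the factor
    \<open>(1 / s) ^ n\<close>, so the terms are at most \<open>s ^ n\<close>.\<close>
  define s where "s = sqrt (sqrt \<rho>)"
  have s: "0 < s" "s < 1" "s\<^sup>2 = sqrt \<rho>"
    using \<rho> by (auto simp: s_def)
  have out: "heat n x = 0" if "x \<notin> carrier G" for n x
    using heat_l_infty[of n] that by (simp add: l_infty_def)
  have heat: "heat n x \<le> (s\<^sup>2) ^ n" for n x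
  proof (cases "x \<in> carrier G")
    case True
    have "(heat n x)\<^sup>2 \<le> \<rho> ^ n"
      using heat_square_le_energy[OF True] heat_energy order_trans by blast
    then have "heat n x \<le> sqrt (\<rho> ^ n)"
      by (rule real_le_rsqrt)
    then show ?thesis
      by (simp add: s real_sqrt_power)
  qed (simp add: out)
  have term_le: "(1 / s) ^ n * heat n x \<le> s ^ n" for n x
  proof -
    have "(1 / s) ^ n * heat n x \<le> (1 / s) ^ n * (s\<^sup>2) ^ n"
      using heat s by (intro mult_left_mono) auto
    also have "\<dots> = s ^ n"
      using s(1) unfolding power_mult_distrib[symmetric] by (simp add: power2_eq_square)
    finally show ?thesis .
  qed
  have nonneg: "0 \<le> (1 / s) ^ n * heat n x" for n x
    using s heat_nonneg by simp
  have geo: "summable (\<lambda>n. s ^ n)"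
    using s by simp
  have summable: "summable (\<lambda>n. (1 / s) ^ n * heat n x)" for x
    using term_le nonneg by (intro summable_comparison_test'[OF geo, of 0]) auto
  define h where "h x = (\<Sum>n. (1 / s) ^ n * heat n x)" for x
  have h_nonneg: "0 \<le> h x" for x
    unfolding h_def using summable nonneg by (rule suminf_nonneg)
  have h_le: "h x \<le> (\<Sum>n. s ^ n)" for x
    unfolding h_def using term_le summable geo by (rule suminf_le)
  have h: "h \<in> l_infty G"
    unfolding l_infty_def using h_nonneg h_le
    by (auto simp: bounded_image_iff h_def out intro!: exI[of _ "\<Sum>n. s ^ n"])
  have "(1 / s) ^ 0 * heat 0 \<one> \<le> h \<one>"
    unfolding h_def using sum_le_suminf[OF summable, of "{0}" \<one>] nonneg by simp
  then have "h \<noteq> (\<lambda>_. 0)"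
    by (auto simp: heat_0)
  moreover have "M h x \<le> h x / (1 / s)" if "x \<in> carrier G" for x
    unfolding h_def using s summable that h[unfolded h_def, THEN l_infty_bdd]
    by (intro M_le_finite_sums green_superharmonic) auto
  ultimately show False
    using stationary_no_contraction[OF P h h_nonneg, of "1 / s"] s by simp
qed

end

section \<open>From slow decay to an invariant mean\<close>

context symmetric_walk
begin

lemma translate_l_infty:
  assumes "f \<in> l_infty G" "g \<in> carrier G"
  shows "left_translate G g f \<in> l_infty G"
proof -
  obtain B where "\<forall>x\<in>carrier G. \<bar>f x\<bar> \<le> B"
    using l_infty_bdd[OF assms(1)] unfolding bounded_image_iff by blast
  then show ?thesis
    using assms(2) by (auto simp: l_infty_def left_translate_def bounded_image_iff intro!: exI[of _ B])
qed

lemma translate_mult: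
  assumes "g \<in> carrier G" "h \<in> carrier G"
  shows "left_translate G (g \<otimes> h) f = left_translate G g (left_translate G h f)"
  using assms by (auto simp: left_translate_def fun_eq_iff inv_mult_group m_assoc)

text \<open>The weight has index \<open>m\<close> but the normalisation has index \<open>n\<close>.
  For \<open>m = Suc n\<close> the total mass is thus at most 1 rather than exactly 1, and the two
  functionals to be compared share a denominator.\<close>

definition weighted_mean :: "nat \<Rightarrow> nat \<Rightarrow> ('a \<Rightarrow> real) \<Rightarrow> real" where
  "weighted_mean n m f = (\<Sum>\<^sub>\<infinity>x\<in>carrier G. f x * (heat m x)\<^sup>2) / heat_energy n"

lemma weighted_summable:
  assumes "\<And>x. x \<in> carrier G \<Longrightarrow> \<bar>f x\<bar> \<le> B"
  shows "(\<lambda>x. f x * (heat m x)\<^sup>2) summable_on carrier G"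
  using assms
  by (intro real_summable_on_comparison[OF summable_on_cmult_right[OF heat_square_summable[of m], of B]])
    (simp add: abs_mult mult_right_mono)

lemma weighted_mean_abs_le:
  assumes B: "\<And>x. x \<in> carrier G \<Longrightarrow> \<bar>f x\<bar> \<le> B" and heat_energy: "0 < heat_energy n" "heat_energy m \<le> heat_energy n"
  shows "\<bar>weighted_mean n m f\<bar> \<le> B"
proof -
  have B0: "0 \<le> B"
    using B[OF one_closed] by simp
  have "norm (\<Sum>\<^sub>\<infinity>x\<in>carrier G. f x * (heat m x)\<^sup>2) \<le> (\<Sum>\<^sub>\<infinity>x\<in>carrier G. B * (heat m x)\<^sup>2)"
  proof (rule norm_infsum_le)
    show "((\<lambda>x. f x * (heat m x)\<^sup>2) has_sum (\<Sum>\<^sub>\<infinity>x\<in>carrier G. f x * (heat m x)\<^sup>2)) (carrier G)"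
      by (intro has_sum_infsum weighted_summable[of f B] B)
    show "((\<lambda>x. B * (heat m x)\<^sup>2) has_sum (\<Sum>\<^sub>\<infinity>x\<in>carrier G. B * (heat m x)\<^sup>2)) (carrier G)"
      by (intro has_sum_infsum summable_on_cmult_right heat_square_summable)
    show "norm (f x * (heat m x)\<^sup>2) \<le> B * (heat m x)\<^sup>2" if "x \<in> carrier G" for x
      using B[OF that] by (simp add: abs_mult mult_right_mono)
  qed
  also have "\<dots> = B * heat_energy m"
    by (simp add: infsum_cmult_right' heat_energy_def)
  also have "\<dots> \<le> B * heat_energy n"
    using B0 heat_energy(2) by (rule mult_left_mono[rotated])
  finally show ?thesis
    using heat_energy(1) by (simp add: weighted_mean_def divide_le_eq)
qed

text \<open>A change of variables moves the translation from \<open>f\<close> to the weight, which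
  becomes the square of \<open>u x = heat n (g \<otimes> x)\<close>. By symmetry
  \<open>inv g\<close> is in the support with the same mass, so the energy drop for
  \<open>inv g\<close> bounds the distance from \<open>u\<close> to \<open>heat (Suc n)\<close>. The
  choice \<open>t = e\<close> in \<open>square_weights_close\<close> makes both error terms of order
  \<open>e\<close>.\<close>

lemma translate_close:
  assumes B: "\<And>x. x \<in> carrier G \<Longrightarrow> \<bar>f x\<bar> \<le> B" and g: "g \<in> set_pmf \<mu>"
    and e: "0 < e" and heat_energy: "(1 - e\<^sup>2) * heat_energy n < heat_energy (Suc n)"
  shows "\<bar>weighted_mean n n (left_translate G g f) - weighted_mean n (Suc n) f\<bar>
    \<le> e * (B * (1 / (2 * pmf \<mu> g) + 2))"
proof -
  have gc: "g \<in> carrier G" "inv g \<in> carrier G"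
    using g supp by auto
  have pg: "pmf \<mu> (inv g) = pmf \<mu> g" "0 < pmf \<mu> g"
    using g gc symm by (auto simp: pmf_positive)
  then have ig: "inv g \<in> set_pmf \<mu>"
    by (simp add: set_pmf_iff)
  have B0: "0 \<le> B"
    using B[OF one_closed] by simp
  have q_pos: "0 < heat_energy n"
  proof -
    have "0 < e\<^sup>2 * heat_energy n"
      using heat_energy heat_energy_antimono[of n] by (simp add: algebra_simps)
    then show ?thesis
      using e by (simp add: zero_less_mult_iff)
  qed
  have bij: "bij_betw ((\<otimes>) g) (carrier G) (carrier G)"
    using gc by (intro bij_betw_byWitness[where f' = "(\<otimes>) (inv g)"]) auto
  define u where "u x = heat n (g \<otimes> x)" for x
  have u: "(\<lambda>x. (u x)\<^sup>2) summable_on carrier G" "(\<Sum>\<^sub>\<infinity>x\<in>carrier G. (u x)\<^sup>2) = heat_energy n"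
    using summable_on_reindex_bij_betw[OF bij, of "\<lambda>x. (heat n x)\<^sup>2"] heat_square_summable[of n]
      infsum_reindex_bij_betw[OF bij, of "\<lambda>x. (heat n x)\<^sup>2"]
    by (simp_all add: u_def heat_energy_def)
  have translate: "(\<Sum>\<^sub>\<infinity>x\<in>carrier G. left_translate G g f x * (heat n x)\<^sup>2) = (\<Sum>\<^sub>\<infinity>x\<in>carrier G. f x * (u x)\<^sup>2)"
  proof -
    have "(\<Sum>\<^sub>\<infinity>x\<in>carrier G. f x * (u x)\<^sup>2)
        = (\<Sum>\<^sub>\<infinity>x\<in>carrier G. left_translate G g f (g \<otimes> x) * (heat n (g \<otimes> x))\<^sup>2)"
      using gc by (intro infsum_cong) (simp add: u_def left_translate_def)
    also have "\<dots> = (\<Sum>\<^sub>\<infinity>x\<in>carrier G. left_translate G g f x * (heat n x)\<^sup>2)"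
      by (rule infsum_reindex_bij_betw[OF bij])
    finally show ?thesis by simp
  qed
  define D where "D = (\<Sum>\<^sub>\<infinity>x\<in>carrier G. (u x - heat (Suc n) x)\<^sup>2)"
  have "pmf \<mu> g * D + heat_energy (Suc n) \<le> heat_energy n"
    using energy_drop[OF ig, of n] gc pg by (simp add: D_def u_def)
  then have "pmf \<mu> g * D \<le> e\<^sup>2 * heat_energy n"
    using heat_energy by (simp add: algebra_simps)
  then have D: "D \<le> e\<^sup>2 * heat_energy n / pmf \<mu> g"
    using pg(2) by (simp add: field_simps)
  have "\<bar>(\<Sum>\<^sub>\<infinity>x\<in>carrier G. f x * (u x)\<^sup>2) - (\<Sum>\<^sub>\<infinity>x\<in>carrier G. f x * (heat (Suc n) x)\<^sup>2)\<bar>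
      \<le> B * (D / (2 * e) + e * (heat_energy n + heat_energy (Suc n)))"
    using square_weights_close[OF u(1) heat_square_summable[of "Suc n"] B e]
    by (simp add: D_def u(2) heat_energy_def)
  also have "\<dots> \<le> B * ((e\<^sup>2 * heat_energy n / pmf \<mu> g) / (2 * e) + e * (heat_energy n + heat_energy n))"
    using B0 D e heat_energy_antimono[of n]
    by (intro mult_left_mono add_mono divide_right_mono) auto
  also have "\<dots> = e * (B * (1 / (2 * pmf \<mu> g) + 2)) * heat_energy n"
    using e pg(2) by (simp add: field_simps power2_eq_square)
  finally show ?thesis
    unfolding weighted_mean_def translate diff_divide_distrib[symmetric]
    using q_pos by (simp add: divide_le_eq)
qed

lemma slow_decay_imp_amenable:
  assumes slow: "\<And>\<rho>. 0 < \<rho> \<Longrightarrow> \<rho> < 1 \<Longrightarrow> \<exists>n. \<rho> * heat_energy n < heat_energy (Suc n)"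
  shows "amenable G"
proof -
  \<comment> \<open>The shift by 2 keeps \<open>e k\<close> strictly below 1, so that
    \<open>1 - (e k)\<^sup>2\<close> is an admissible decay rate even for
    \<open>k = 0\<close>.\<close>
  define e :: "nat \<Rightarrow> real" where "e k = 1 / real (k + 2)" for k
  have e: "0 < e k" "e k < 1" for k
    by (auto simp: e_def)
  have e_lim: "e \<longlonglongrightarrow> 0"
    unfolding e_def using LIMSEQ_ignore_initial_segment[OF lim_1_over_n[where 'a = real], of 2] by simp
  have "\<exists>n. (1 - (e k)\<^sup>2) * heat_energy n < heat_energy (Suc n)" for k
  proof (rule slow)
    show "0 < 1 - (e k)\<^sup>2" "1 - (e k)\<^sup>2 < 1"
      using e[of k] by (auto simp: abs_square_less_1)
  qed
  then obtain n where n: "\<And>k. (1 - (e k)\<^sup>2) * heat_energy (n k) < heat_energy (Suc (n k))"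
    by metis
  have q_pos: "0 < heat_energy (n k)" for k
  proof -
    have "0 < (e k)\<^sup>2 * heat_energy (n k)"
      using n[of k] heat_energy_antimono[of "n k"] by (simp add: algebra_simps)
    then show ?thesis
      using e[of k] by (simp add: zero_less_mult_iff)
  qed
  define \<psi> where "\<psi> f k = weighted_mean (n k) (n k) f" for f k
  define \<kappa> where "\<kappa> f k = weighted_mean (n k) (Suc (n k)) f" for f k
  obtain L :: "(nat \<Rightarrow> real) \<Rightarrow> real" where L:
    "\<And>x y. Bseq x \<Longrightarrow> Bseq y \<Longrightarrow> L (\<lambda>n. x n + y n) = L x + L y"
    "\<And>x y. Bseq x \<Longrightarrow> Bseq y \<Longrightarrow> L (\<lambda>n. x n * y n) = L x * L y"
    "\<And>x heat. Bseq x \<Longrightarrow> (\<And>n. heat \<le> x n) \<Longrightarrow> heat \<le> L x"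
    "\<And>x heat. Bseq x \<Longrightarrow> (\<And>n. x n \<le> heat) \<Longrightarrow> L x \<le> heat"
    "\<And>x l. x \<longlonglongrightarrow> l \<Longrightarrow> L x = l"
    by (rule ultralimit_exists) blast
  have bound: "\<exists>B. \<forall>x\<in>carrier G. \<bar>f x\<bar> \<le> B" if "f \<in> l_infty G" for f
    using l_infty_bdd[OF that] by (simp add: bounded_image_iff)
  have B\<psi>: "Bseq (\<psi> f)" and B\<kappa>: "Bseq (\<kappa> f)" if f: "f \<in> l_infty G" for f
  proof -
    obtain B where B: "\<And>x. x \<in> carrier G \<Longrightarrow> \<bar>f x\<bar> \<le> B"
      using bound[OF f] by blast
    have "norm (\<psi> f k) \<le> B" for k
      unfolding \<psi>_def real_norm_def by (rule weighted_mean_abs_le[OF B q_pos order_refl])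
    then show "Bseq (\<psi> f)"
      by (rule BseqI')
    have "norm (\<kappa> f k) \<le> B" for k
      unfolding \<kappa>_def real_norm_def by (rule weighted_mean_abs_le[OF B q_pos heat_energy_antimono])
    then show "Bseq (\<kappa> f)"
      by (rule BseqI')
  qed
  have \<psi>_add: "\<psi> (\<lambda>x. f x + h x) k = \<psi> f k + \<psi> h k" if fh: "f \<in> l_infty G" "h \<in> l_infty G" for f h k
  proof -
    obtain B C where B: "\<And>x. x \<in> carrier G \<Longrightarrow> \<bar>f x\<bar> \<le> B" and C: "\<And>x. x \<in> carrier G \<Longrightarrow> \<bar>h x\<bar> \<le> C"
      using bound[OF fh(1)] bound[OF fh(2)] by blast
    have "(\<Sum>\<^sub>\<infinity>x\<in>carrier G. f x * (heat (n k) x)\<^sup>2 + h x * (heat (n k) x)\<^sup>2)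
        = (\<Sum>\<^sub>\<infinity>x\<in>carrier G. f x * (heat (n k) x)\<^sup>2) + (\<Sum>\<^sub>\<infinity>x\<in>carrier G. h x * (heat (n k) x)\<^sup>2)"
      by (intro infsum_add weighted_summable[of f B] weighted_summable[of h C] B C)
    then show ?thesis
      by (simp add: \<psi>_def weighted_mean_def distrib_right add_divide_distrib)
  qed
  have \<psi>_cmult: "\<psi> (\<lambda>x. c * f x) k = c * \<psi> f k" for f c k
    by (simp add: \<psi>_def weighted_mean_def mult.assoc infsum_cmult_right')
  have \<psi>_nonneg: "0 \<le> \<psi> f k" if "(\<lambda>_. 0) \<le> f" for f k
    using that heat_energy_nonneg by (auto simp: \<psi>_def weighted_mean_def le_fun_def intro!: divide_nonneg_nonneg infsum_nonneg)
  have \<psi>_one: "\<psi> (indicator (carrier G)) k = 1" for k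
  proof -
    have "(\<Sum>\<^sub>\<infinity>x\<in>carrier G. indicator (carrier G) x * (heat (n k) x)\<^sup>2) = heat_energy (n k)"
      unfolding heat_energy_def by (rule infsum_cong) simp
    then show ?thesis
      using q_pos[of k] by (simp add: \<psi>_def weighted_mean_def)
  qed
  define m where "m f = L (\<psi> f)" for f
  have m_add: "m (\<lambda>x. f x + h x) = m f + m h" if "f \<in> l_infty G" "h \<in> l_infty G" for f h
  proof -
    have "\<psi> (\<lambda>x. f x + h x) = (\<lambda>k. \<psi> f k + \<psi> h k)"
      using \<psi>_add[OF that] by blast
    then show ?thesis
      unfolding m_def by (simp add: L(1) B\<psi> that)
  qed
  have const: "L (\<lambda>_. c) = c" "Bseq (\<lambda>_. c)" for c
    by (rule L(5)[OF tendsto_const]) simp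
  have m_cmult: "m (\<lambda>x. c * f x) = c * m f" if "f \<in> l_infty G" for c f
  proof -
    have "\<psi> (\<lambda>x. c * f x) = (\<lambda>k. c * \<psi> f k)"
      by (simp add: \<psi>_cmult fun_eq_iff)
    then show ?thesis
      unfolding m_def by (simp add: L(2)[OF const(2) B\<psi>[OF that]] const(1))
  qed
  have m_nonneg: "0 \<le> m f" if "f \<in> l_infty G" "(\<lambda>_. 0) \<le> f" for f
    unfolding m_def by (intro L(3) B\<psi> \<psi>_nonneg that)
  have m_one: "m (indicator (carrier G)) = 1"
  proof -
    have "\<psi> (indicator (carrier G)) = (\<lambda>_. 1)"
      using \<psi>_one by blast
    then show ?thesis
      by (simp add: m_def const(1))
  qed
  \<comment> \<open>The right-hand side does not involve \<open>g\<close>: all translates by the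
    support have the same value under \<open>m\<close>.\<close>
  have m_shift: "m (left_translate G g f) = L (\<kappa> f)" if g: "g \<in> set_pmf \<mu>" and f: "f \<in> l_infty G" for g f
  proof -
    obtain B where B: "\<And>x. x \<in> carrier G \<Longrightarrow> \<bar>f x\<bar> \<le> B"
      using bound[OF f] by blast
    define d where "d k = \<psi> (left_translate G g f) k - \<kappa> f k" for k
    have "norm (d k) \<le> e k * (B * (1 / (2 * pmf \<mu> g) + 2))" for k
      unfolding d_def \<psi>_def \<kappa>_def real_norm_def by (rule translate_close[OF B g e(1) n])
    then have "eventually (\<lambda>k. norm (d k) \<le> e k * (B * (1 / (2 * pmf \<mu> g) + 2))) sequentially"
      by simp
    then have d: "d \<longlonglongrightarrow> 0"
      by (rule Lim_null_comparison) (rule tendsto_mult_left_zero[OF e_lim])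
    have "Bseq d"
      by (rule convergent_imp_Bseq[OF convergentI[OF d]])
    have "\<psi> (left_translate G g f) = (\<lambda>k. \<kappa> f k + d k)"
      by (simp add: d_def)
    then have "m (left_translate G g f) = L (\<kappa> f) + L d"
      unfolding m_def using L(1)[OF B\<kappa>[OF f] \<open>Bseq d\<close>] by simp
    then show ?thesis
      unfolding L(5)[OF d] by simp
  qed
  obtain s where s: "s \<in> set_pmf \<mu>"
    using set_pmf_not_empty[of \<mu>] by blast
  then have sc: "s \<in> carrier G"
    using supp by blast
  \<comment> \<open>\<open>m\<close> agrees on all translates by the support of \<open>\<mu>\<close>, but such a translate need not agree with
    the function itself (parity obstruction); averaging over one step repairs this.\<close>
  define m' where "m' f = (m f + m (left_translate G s f)) / 2" for f
  have step: "m' (left_translate G g f) = m' f" if g: "g \<in> set_pmf \<mu>" and f: "f \<in> l_infty G" for g f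
  proof -
    have gc: "g \<in> carrier G"
      using g supp by blast
    then have ig: "inv g \<in> set_pmf \<mu>"
      using g by (simp add: set_pmf_iff symm)
    note gf = translate_l_infty[OF f gc]
    \<comment> \<open>Both \<open>s\<close> and \<open>inv g\<close> lie in the support, so applied
      to the translate of \<open>f\<close> by \<open>g\<close> they give equal values of
      \<open>m\<close>, and \<open>inv g\<close> brings back \<open>f\<close>.\<close>
    have "left_translate G (inv g) (left_translate G g f) = f"
      using f gc by (auto simp: left_translate_def fun_eq_iff l_infty_def)
    then have "m (left_translate G s (left_translate G g f)) = m f"
      using m_shift[OF s gf] m_shift[OF ig gf] by simp
    moreover have "m (left_translate G g f) = m (left_translate G s f)"
      using m_shift[OF s f] m_shift[OF g f] by simp
    ultimately show ?thesis
      by (simp add: m'_def)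
  qed
  have invariant: "g \<in> carrier G \<and> (\<forall>f\<in>l_infty G. m' (left_translate G g f) = m' f)"
    if "g \<in> semigroup_generate G (set_pmf \<mu>)" for g
    using that
  proof (induction rule: semigroup_generate.induct)
    case (incl g)
    then show ?case
      using step supp by blast
  next
    case (mult g h)
    then show ?case
      by (simp add: translate_mult translate_l_infty)
  qed
  have "mean_on G m'"
    unfolding mean_on_def
  proof (intro conjI ballI allI impI)
    fix f h assume fh: "f \<in> l_infty G" "h \<in> l_infty G"
    have "left_translate G s (\<lambda>x. f x + h x) = (\<lambda>x. left_translate G s f x + left_translate G s h x)"
      by (simp add: left_translate_def fun_eq_iff)
    then show "m' (\<lambda>x. f x + h x) = m' f + m' h"
      using fh by (simp add: m'_def m_add translate_l_infty sc field_simps)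
  next
    fix f c assume f: "f \<in> l_infty G"
    have "left_translate G s (\<lambda>x. c * f x) = (\<lambda>x. c * left_translate G s f x)"
      by (simp add: left_translate_def fun_eq_iff)
    then show "m' (\<lambda>x. c * f x) = c * m' f"
      using f by (simp add: m'_def m_cmult translate_l_infty sc field_simps)
  next
    fix f :: "'a \<Rightarrow> real" assume f: "f \<in> l_infty G" "(\<lambda>_. 0) \<le> f"
    have "(\<lambda>_. 0) \<le> left_translate G s f"
      using f(2) by (simp add: left_translate_def le_fun_def)
    then show "0 \<le> m' f"
      using f by (simp add: m'_def m_nonneg translate_l_infty sc)
  next
    have "left_translate G s (indicator (carrier G)) = (indicator (carrier G) :: 'a \<Rightarrow> real)"
      using sc by (auto simp: left_translate_def fun_eq_iff)
    then show "m' (indicator (carrier G)) = 1"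
      by (simp add: m'_def m_one)
  qed
  then show ?thesis
    unfolding amenable_def using invariant[unfolded gen] by blast
qed

end

section \<open>From an invariant mean to a divergent Green series\<close>

lemma mean_onD:
  assumes "mean_on G m"
  shows "f \<in> l_infty G \<Longrightarrow> h \<in> l_infty G \<Longrightarrow> m (\<lambda>x. f x + h x) = m f + m h"
    and "f \<in> l_infty G \<Longrightarrow> m (\<lambda>x. c * f x) = c * m f"
    and "f \<in> l_infty G \<Longrightarrow> (\<And>x. 0 \<le> f x) \<Longrightarrow> 0 \<le> m f"
    and "m (indicator (carrier G)) = 1"
  using assms unfolding mean_on_def le_fun_def by blast+

lemma l_infty_add: "f \<in> l_infty G \<Longrightarrow> h \<in> l_infty G \<Longrightarrow> (\<lambda>x. f x + h x) \<in> l_infty G"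
  by (simp add: l_infty_def bounded_plus_comp)

lemma l_infty_cmult: "f \<in> l_infty G \<Longrightarrow> (\<lambda>x. c * f x) \<in> l_infty G"
  by (simp add: l_infty_def bounded_image_cmult)

lemma l_infty_indicator: "indicator (carrier G) \<in> l_infty G"
  by (auto simp: l_infty_def bounded_image_iff intro!: exI[of _ 1])

lemma mean_sum:
  assumes "mean_on G m" "finite I" "\<And>i. i \<in> I \<Longrightarrow> f i \<in> l_infty G"
  shows "(\<lambda>x. \<Sum>i\<in>I. f i x) \<in> l_infty G \<and> m (\<lambda>x. \<Sum>i\<in>I. f i x) = (\<Sum>i\<in>I. m (f i))"
  using assms(2,3)
proof (induction rule: finite_induct)
  case empty
  then show ?case
    using mean_onD(2)[OF assms(1) l_infty_indicator, of 0] by (simp add: l_infty_def)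
next
  case (insert i I)
  then show ?case
    by (simp add: mean_onD(1)[OF assms(1)] l_infty_add)
qed

context symmetric_walk
begin

lemma finite_pmf_approx:
  assumes "p < 1"
  shows "\<exists>F. finite F \<and> F \<subseteq> carrier G \<and> p < sum (pmf \<mu>) F"
proof (rule ccontr)
  assume "\<not> ?thesis"
  then have "infsum (pmf \<mu>) (carrier G) \<le> p"
    by (intro infsum_le_finite_sums pmf_summable) (meson not_le)
  then show False
    using assms by (simp add: pmf_infsum)
qed

text \<open>The logarithm of the Green function may be unbounded, so the mean is applied only to its
  increments \<open>D g\<close>. Invariance makes their symmetric averages vanish, and
  superharmonicity makes such an average strictly negative.\<close>

lemma amenable_imp_green_diverges:
  assumes "amenable G" "r > 1"
  shows "\<not> summable (\<lambda>n. r ^ n * heat n \<one>)"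
proof
  assume su1: "summable (\<lambda>n. r ^ n * heat n \<one>)"
  have r: "0 < r"
    using assms(2) by simp
  have term_nonneg: "0 \<le> r ^ n * heat n x" for n x
    using r heat_nonneg by simp
  \<comment> \<open>Convergence at the unit spreads to every \<open>x\<close>, since Harnack bounds
    \<open>heat n x\<close> by a constant times \<open>heat (n + m)\<close> at the unit.\<close>
  have su: "summable (\<lambda>n. r ^ n * heat n x)" if x: "x \<in> carrier G" for x
  proof -
    obtain m c where c: "c > 0" and H: "\<forall>n. \<forall>y\<in>carrier G. c * heat n y \<le> heat (n + m) (inv x \<otimes> y)"
      using harnack_heat[OF inv_closed[OF x]] by blast
    have le: "c * heat n x \<le> heat (n + m) \<one>" for n
      using H[rule_format, OF x, of n] x by simp
    have shift: "summable (\<lambda>n. r ^ (n + m) * heat (n + m) \<one>)"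
      using su1 by (rule summable_ignore_initial_segment)
    have "norm (r ^ n * heat n x) \<le> (1 / (c * r ^ m)) * (r ^ (n + m) * heat (n + m) \<one>)" for n
    proof -
      have "norm (r ^ n * heat n x) = (1 / (c * r ^ m)) * (r ^ (n + m) * (c * heat n x))"
        using r c heat_nonneg[of n x] by (simp add: power_add abs_mult)
      also have "\<dots> \<le> (1 / (c * r ^ m)) * (r ^ (n + m) * heat (n + m) \<one>)"
        using le r c by (intro mult_left_mono) simp_all
      finally show ?thesis .
    qed
    then show ?thesis
      by (rule summable_comparison_test'[OF summable_mult[OF shift, of "1 / (c * r ^ m)"], of 0])
  qed
  define u where "u x = (\<Sum>n. r ^ n * heat n x)" for x
  have u_harnack: "\<exists>C>0. \<forall>x\<in>carrier G. C * u x \<le> u (g \<otimes> x)" if g: "g \<in> carrier G" for g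
  proof -
    obtain m c where c: "c > 0" and H: "\<forall>n. \<forall>y\<in>carrier G. c * heat n y \<le> heat (n + m) (g \<otimes> y)"
      using harnack_heat[OF g] by blast
    have "(c * r ^ m) * u x \<le> u (g \<otimes> x)" if x: "x \<in> carrier G" for x
    proof -
      have gx: "g \<otimes> x \<in> carrier G"
        using g x by simp
      note le = H[rule_format, OF x]
      have "(c * r ^ m) * u x = (\<Sum>n. (c * r ^ m) * (r ^ n * heat n x))"
        unfolding u_def using su[OF x] by (rule suminf_mult[symmetric])
      also have "\<dots> \<le> (\<Sum>n. r ^ (n + m) * heat (n + m) (g \<otimes> x))"
      proof (rule suminf_le)
        show "summable (\<lambda>n. (c * r ^ m) * (r ^ n * heat n x))"
          using su[OF x] by (rule summable_mult)
        show "summable (\<lambda>n. r ^ (n + m) * heat (n + m) (g \<otimes> x))"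
          using su[OF gx] by (rule summable_ignore_initial_segment)
        show "(c * r ^ m) * (r ^ n * heat n x) \<le> r ^ (n + m) * heat (n + m) (g \<otimes> x)" for n
          using mult_left_mono[OF le[of n], of "r ^ (n + m)"] r by (simp add: power_add mult_ac)
      qed
      also have "\<dots> \<le> u (g \<otimes> x)"
        using suminf_split_initial_segment[OF su[OF gx], of m] term_nonneg
        by (simp add: u_def sum_nonneg)
      finally show ?thesis .
    qed
    moreover have "0 < c * r ^ m"
      using c r by simp
    ultimately show ?thesis
      by blast
  qed
  have u_one: "1 \<le> u \<one>"
    using sum_le_suminf[OF su1, of "{0}"] term_nonneg by (simp add: u_def heat_0)
  have u_pos: "0 < u x" if x: "x \<in> carrier G" for x
  proof -
    obtain C where "C > 0" "C * u \<one> \<le> u (x \<otimes> \<one>)"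
      using u_harnack[OF x] by blast
    moreover have "0 < C * u \<one>"
      using u_one \<open>C > 0\<close> by simp
    ultimately show ?thesis
      using x by simp
  qed
  define D where "D g x = (if x \<in> carrier G then ln (u (inv g \<otimes> x)) - ln (u x) else 0)" for g x
  \<comment> \<open>Harnack for \<open>inv g\<close> bounds the increment from below, Harnack for
    \<open>g\<close> from above.\<close>
  have D: "D g \<in> l_infty G" if g: "g \<in> carrier G" for g
  proof -
    obtain C where C: "C > 0" "\<And>x. x \<in> carrier G \<Longrightarrow> C * u x \<le> u (inv g \<otimes> x)"
      using u_harnack[OF inv_closed[OF g]] by blast
    obtain C' where C': "C' > 0" "\<And>x. x \<in> carrier G \<Longrightarrow> C' * u x \<le> u (g \<otimes> x)"
      using u_harnack[OF g] by blast
    have "\<bar>D g x\<bar> \<le> \<bar>ln C\<bar> + \<bar>ln C'\<bar>" if x: "x \<in> carrier G" for x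
    proof -
      have y: "inv g \<otimes> x \<in> carrier G"
        using g x by simp
      have "ln (C * u x) \<le> ln (u (inv g \<otimes> x))" "ln (C' * u (inv g \<otimes> x)) \<le> ln (u x)"
        using C(2)[OF x] C'(2)[OF y] C(1) C'(1) u_pos[OF x] u_pos[OF y] g x by simp_all
      then show ?thesis
        using C(1) C'(1) u_pos[OF x] u_pos[OF y] x by (simp add: D_def ln_mult)
    qed
    then have "bdd (D g)"
      unfolding bounded_image_iff by blast
    then show ?thesis
      by (simp add: l_infty_def D_def)
  qed
  obtain m where m: "mean_on G m"
    and inv_m: "\<And>g f. g \<in> carrier G \<Longrightarrow> f \<in> l_infty G \<Longrightarrow> m (left_translate G g f) = m f"
    using assms(1) unfolding amenable_def by blast
  note m_simps = mean_onD[OF m]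
  \<comment> \<open>Translating \<open>D (inv g)\<close> by \<open>g\<close> exchanges the two
    logarithms.\<close>
  have anti: "m (D (inv g)) = - m (D g)" if g: "g \<in> carrier G" for g
  proof -
    have "left_translate G g (D (inv g)) = (\<lambda>x. (- 1) * D g x)"
      using g by (auto simp: left_translate_def D_def fun_eq_iff)
    then have "m (D (inv g)) = m (\<lambda>x. (- 1) * D g x)"
      using inv_m[OF g D[OF inv_closed[OF g]]] by simp
    also have "\<dots> = (- 1) * m (D g)"
      by (rule m_simps(2)[OF D[OF g]])
    finally show ?thesis by simp
  qed
  have ln_r: "0 < ln r"
    using assms(2) by simp
  \<comment> \<open>The mean is only finitely additive, so the average over \<open>\<mu>\<close> is
    cut down to a finite set. Mass above \<open>1 / (1 + ln r)\<close> is what makes the later bound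
    \<open>1 - p * (1 + ln r)\<close> negative.\<close>
  then obtain F0 where F0: "finite F0" "F0 \<subseteq> carrier G" "1 / (1 + ln r) < sum (pmf \<mu>) F0"
    using finite_pmf_approx[of "1 / (1 + ln r)"] by fastforce
  \<comment> \<open>Closing the set under inverses makes the terms for \<open>g\<close> and
    \<open>inv g\<close> cancel, hence \<open>m S = 0\<close>.\<close>
  define F where "F = F0 \<union> (\<lambda>g. inv g) ` F0"
  have F: "finite F" "F \<subseteq> carrier G"
    using F0 by (auto simp: F_def)
  have F_inv: "(\<lambda>g. inv g) ` F = F"
  proof -
    have "(\<lambda>g. inv (inv g)) ` F0 = (\<lambda>g. g) ` F0"
      using F0(2) by (intro image_cong) auto
    then show ?thesis
      by (simp add: F_def image_Un image_image Un_commute)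
  qed
  define p where "p = sum (pmf \<mu>) F"
  have "sum (pmf \<mu>) F0 \<le> p"
    unfolding p_def using F by (intro sum_mono2) (auto simp: F_def)
  then have "sum (pmf \<mu>) F0 * (1 + ln r) \<le> p * (1 + ln r)"
    using ln_r by (intro mult_right_mono) simp_all
  moreover have "1 < sum (pmf \<mu>) F0 * (1 + ln r)"
    using F0(3) ln_r by (simp add: pos_divide_less_eq)
  ultimately have p: "1 < p * (1 + ln r)"
    by (rule less_le_trans[rotated])
  define S where "S x = (\<Sum>g\<in>F. pmf \<mu> g * D g x)" for x
  have Dc: "(\<lambda>x. pmf \<mu> g * D g x) \<in> l_infty G" if "g \<in> F" for g
    using D F(2) that by (intro l_infty_cmult) auto
  have "S \<in> l_infty G \<and> m S = (\<Sum>g\<in>F. m (\<lambda>x. pmf \<mu> g * D g x))"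
    unfolding S_def by (rule mean_sum[OF m F(1) Dc])
  moreover have "m (\<lambda>x. pmf \<mu> g * D g x) = pmf \<mu> g * m (D g)" if "g \<in> F" for g
    using that F(2) by (intro m_simps(2) D) auto
  ultimately have S: "S \<in> l_infty G" "m S = (\<Sum>g\<in>F. pmf \<mu> g * m (D g))"
    by simp_all
  have "(\<Sum>g\<in>F. pmf \<mu> g * m (D g)) = (\<Sum>g\<in>F. pmf \<mu> (inv g) * m (D (inv g)))"
  proof -
    have "inj_on (\<lambda>g. inv g) F"
      using F(2) by (auto intro!: inj_onI simp: subset_iff dest: arg_cong[of _ _ "\<lambda>g. inv g"])
    then show ?thesis
      using sum.reindex[of "\<lambda>g. inv g" F "\<lambda>g. pmf \<mu> g * m (D g)"] F_inv by simp
  qed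
  also have "\<dots> = (\<Sum>g\<in>F. - (pmf \<mu> g * m (D g)))"
    using F(2) by (intro sum.cong) (auto simp: anti symm subset_iff)
  finally have "m S = 0"
    unfolding S(2) by (simp add: sum_negf)
  \<comment> \<open>Apply \<open>ln t \<le> t - 1\<close> to
    \<open>t = r * (u (inv g \<otimes> x) / u x)\<close>. The sum of these \<open>t\<close> over
    \<open>F\<close>, weighted by \<open>\<mu>\<close>, is at most 1 by
    \<open>green_superharmonic\<close>.\<close>
  have S_le: "S x \<le> 1 - p * (1 + ln r)" if x: "x \<in> carrier G" for x
  proof -
    have "S x \<le> (\<Sum>g\<in>F. pmf \<mu> g * (r * (u (inv g \<otimes> x) / u x) - (1 + ln r)))"
      unfolding S_def
    proof (intro sum_mono mult_left_mono)
      fix g assume "g \<in> F"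
      then have y: "inv g \<otimes> x \<in> carrier G"
        using F(2) x by auto
      have "ln (r * (u (inv g \<otimes> x) / u x)) \<le> r * (u (inv g \<otimes> x) / u x) - 1"
        using r u_pos[OF x] u_pos[OF y] by (intro ln_le_minus_one) simp
      moreover have "ln (r * (u (inv g \<otimes> x) / u x)) = ln r + D g x"
        using r u_pos[OF x] u_pos[OF y] x by (simp add: ln_mult ln_div D_def)
      ultimately show "D g x \<le> r * (u (inv g \<otimes> x) / u x) - (1 + ln r)"
        by simp
    qed simp
    also have "\<dots> = (r / u x) * (\<Sum>g\<in>F. pmf \<mu> g * u (inv g \<otimes> x)) - p * (1 + ln r)"
      by (simp add: p_def right_diff_distrib sum_subtractf sum_distrib_left sum_distrib_right
          mult_ac)
    also have "\<dots> \<le> (r / u x) * (u x / r) - p * (1 + ln r)"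
      using green_superharmonic[OF r su F x] r u_pos[OF x]
      by (intro diff_right_mono mult_left_mono) (auto simp: u_def)
    also have "\<dots> = 1 - p * (1 + ln r)"
      using r u_pos[OF x] by simp
    finally show ?thesis .
  qed
  define \<delta> where "\<delta> = p * (1 + ln r) - 1"
  have T: "(\<lambda>x. (- \<delta>) * indicator (carrier G) x) \<in> l_infty G" "(\<lambda>x. (- 1) * S x) \<in> l_infty G"
    by (rule l_infty_cmult[OF l_infty_indicator]) (rule l_infty_cmult[OF S(1)])
  have "0 \<le> m (\<lambda>x. (- \<delta>) * indicator (carrier G) x + (- 1) * S x)"
  proof (rule m_simps(3)[OF l_infty_add[OF T]])
    show "0 \<le> (- \<delta>) * indicator (carrier G) x + (- 1) * S x" for x
      using S_le[of x] by (cases "x \<in> carrier G") (simp_all add: \<delta>_def S_def D_def)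
  qed
  also have "\<dots> = - \<delta>"
    unfolding m_simps(1)[OF T] m_simps(2)[OF l_infty_indicator] m_simps(2)[OF S(1)] m_simps(4)
      \<open>m S = 0\<close> by simp
  finally show False
    using p by (simp add: \<delta>_def)
qed

end

section \<open>From a divergent Green series to a conditional mean\<close>

text \<open>The weight grows like \<open>r ^ n\<close> until \<open>r ^ (2 n)\<close> reaches
  \<open>K\<close> and decays geometrically afterwards. The parameter \<open>K\<close> fixes the
  length of the growing phase; the decay makes sums against bounded sequences converge.\<close>

definition tent :: "real \<Rightarrow> real \<Rightarrow> nat \<Rightarrow> real" where
  "tent r K n = min (r ^ n) (K / r ^ n)"

context
  fixes r K :: real
  assumes r: "1 < r" and K: "1 \<le> K"
begin

lemma tent_pos: "0 < tent r K n"
  using r K by (simp add: tent_def)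

lemma tent_0: "tent r K 0 = 1"
  using K by (simp add: tent_def)

lemma tent_le: "tent r K n \<le> K * (1 / r) ^ n"
  by (simp add: tent_def power_divide)

text \<open>Each branch of the minimum changes by at most a factor \<open>r\<close> per step, in
  either direction, hence so does the minimum. This is the source of near stationarity as
  \<open>r\<close> tends to 1.\<close>

lemma tent_le_Suc: "tent r K n \<le> r * tent r K (Suc n)"
proof -
  have "r ^ n * 1 \<le> r ^ n * r\<^sup>2"
    using r by (intro mult_left_mono) simp_all
  then have "tent r K n \<le> r * r ^ Suc n"
    by (simp add: tent_def power2_eq_square mult_ac min_le_iff_disj)
  moreover have "tent r K n \<le> r * (K / r ^ Suc n)"
    using r by (simp add: tent_def)
  ultimately have "tent r K n / r \<le> tent r K (Suc n)"
    unfolding tent_def[of r K "Suc n"] using r by (simp add: pos_divide_le_eq mult.commute)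
  then show ?thesis
    using r by (simp add: pos_divide_le_eq mult.commute)
qed

lemma tent_Suc_le: "tent r K (Suc n) \<le> r * tent r K n"
proof -
  have "K / (r * r ^ n) \<le> K / r ^ n * 1"
    using r K by (simp add: divide_simps)
  also have "\<dots> \<le> K / r ^ n * r"
    using r K by (intro mult_left_mono) simp_all
  finally have "tent r K (Suc n) \<le> r * (K / r ^ n)"
    by (simp add: tent_def min_le_iff_disj mult.commute)
  moreover have "tent r K (Suc n) \<le> r * r ^ n"
    by (simp add: tent_def)
  ultimately have "tent r K (Suc n) / r \<le> tent r K n"
    unfolding tent_def[of r K n] using r by (simp add: pos_divide_le_eq mult.commute)
  then show ?thesis
    using r by (simp add: pos_divide_le_eq mult.commute)
qed

lemma tent_le_add: "tent r K n \<le> r ^ m * tent r K (n + m)"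
proof (induction m)
  case (Suc m)
  have "r ^ m * tent r K (n + m) \<le> r ^ m * (r * tent r K (Suc (n + m)))"
    using r tent_le_Suc by (intro mult_left_mono) simp_all
  with Suc show ?case
    by (simp add: mult_ac)
qed simp

end

section \<open>Tent-weighted functionals and their normalised limits\<close>

context symmetric_walk
begin

definition weight :: "real \<Rightarrow> real \<Rightarrow> ('a \<Rightarrow> real) \<Rightarrow> real" where
  "weight r K f = (\<Sum>n. tent r K n * (M ^^ n) f \<one>)"

context
  fixes r K :: real
  assumes r: "1 < r" and K: "1 \<le> K"
begin

lemma weight_summable:
  assumes "bdd f"
  shows "summable (\<lambda>n. tent r K n * (M ^^ n) f \<one>)"
proof -
  obtain B where B: "\<And>x. x \<in> carrier G \<Longrightarrow> \<bar>f x\<bar> \<le> B"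
    using assms unfolding bounded_image_iff by blast
  have geo: "summable (\<lambda>n. K * B * (1 / r) ^ n)"
    using r by (intro summable_mult summable_geometric) simp
  have "norm (tent r K n * (M ^^ n) f \<one>) \<le> K * B * (1 / r) ^ n" for n
  proof -
    have "norm (tent r K n * (M ^^ n) f \<one>) = tent r K n * \<bar>(M ^^ n) f \<one>\<bar>"
      using tent_pos[OF r K, of n] by (simp add: abs_mult)
    also have "\<dots> \<le> (K * (1 / r) ^ n) * B"
      using tent_le[OF r K, of n] tent_pos[OF r K, of n] iter_abs_le[of f B \<one> n, OF B one_closed]
      by (intro mult_mono) linarith+
    finally show ?thesis
      by (simp add: mult_ac)
  qed
  then show ?thesis
    by (rule summable_comparison_test'[OF geo, of 0])
qed

lemma weight_add:
  assumes "bdd f" "bdd h"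
  shows "weight r K (\<lambda>x. f x + h x) = weight r K f + weight r K h"
  unfolding weight_def
  by (simp add: iter_add[OF assms] distrib_left suminf_add weight_summable assms)

lemma weight_mono:
  assumes "bdd f" "bdd h" "\<And>x. f x \<le> h x"
  shows "weight r K f \<le> weight r K h"
  unfolding weight_def
  using assms tent_pos[OF r K]
  by (intro suminf_le weight_summable mult_left_mono iter_mono) (auto intro: less_imp_le)

lemma weight_nonneg:
  assumes "bdd f" "\<And>x. 0 \<le> f x"
  shows "0 \<le> weight r K f"
  unfolding weight_def
  using assms tent_pos[OF r K]
  by (intro suminf_nonneg weight_summable mult_nonneg_nonneg iter_nonneg) (auto intro: less_imp_le)

lemma weight_split:
  assumes "bdd f"
  shows "weight r K f = f \<one> + (\<Sum>n. tent r K (Suc n) * (M ^^ n) (M f) \<one>)"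
  using suminf_split_head[OF weight_summable[OF assms]] tent_0[OF r K]
  by (simp add: weight_def funpow_Suc_right del: funpow.simps)

text \<open>Passing from \<open>f\<close> to \<open>M f\<close> shifts the summation index, which
  costs a factor \<open>r\<close> in the tent weights. The term of index 0 is left over as
  \<open>f \<one>\<close>; it becomes negligible only after division by a large weight.\<close>

lemma weight_stationary:
  assumes f: "bdd f" "\<And>x. 0 \<le> f x"
  shows "weight r K (M f) \<le> r * weight r K f" "weight r K f \<le> f \<one> + r * weight r K (M f)"
proof -
  have c: "0 \<le> (M ^^ n) (M f) \<one>" for n
    using f by (intro iter_nonneg M_nonneg) auto
  have su: "summable (\<lambda>n. tent r K n * (M ^^ n) (M f) \<one>)"
    by (rule weight_summable[OF M_bdd[OF f(1)]])
  have su': "summable (\<lambda>n. tent r K (Suc n) * (M ^^ n) (M f) \<one>)"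
    using summable_ignore_initial_segment[OF weight_summable[OF f(1)], of 1]
    by (simp add: funpow_Suc_right del: funpow.simps)
  have "weight r K (M f) \<le> (\<Sum>n. r * (tent r K (Suc n) * (M ^^ n) (M f) \<one>))"
    unfolding weight_def
  proof (intro suminf_le su summable_mult su')
    show "tent r K n * (M ^^ n) (M f) \<one> \<le> r * (tent r K (Suc n) * (M ^^ n) (M f) \<one>)" for n
      using mult_right_mono[OF tent_le_Suc[OF r K, of n] c[of n]] by (simp add: mult.assoc)
  qed
  also have "\<dots> = r * (\<Sum>n. tent r K (Suc n) * (M ^^ n) (M f) \<one>)"
    by (rule suminf_mult[OF su'])
  also have "\<dots> \<le> r * weight r K f"
    using r f(2)[of \<one>] by (intro mult_left_mono) (simp_all add: weight_split[OF f(1)])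
  finally show "weight r K (M f) \<le> r * weight r K f" .
  have "(\<Sum>n. tent r K (Suc n) * (M ^^ n) (M f) \<one>) \<le> (\<Sum>n. r * (tent r K n * (M ^^ n) (M f) \<one>))"
  proof (intro suminf_le su' summable_mult su)
    show "tent r K (Suc n) * (M ^^ n) (M f) \<one> \<le> r * (tent r K n * (M ^^ n) (M f) \<one>)" for n
      using mult_right_mono[OF tent_Suc_le[OF r K, of n] c[of n]] by (simp add: mult.assoc)
  qed
  also have "\<dots> = r * weight r K (M f)"
    unfolding weight_def by (rule suminf_mult[OF su])
  finally show "weight r K f \<le> f \<one> + r * weight r K (M f)"
    by (simp add: weight_split[OF f(1)])
qed

end

text \<open>Harnack carries the positive value \<open>h x\<close> to the unit, so
  \<open>(M ^^ m) h\<close> dominates a multiple of \<open>heat 0\<close>, and this persists under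
  further iteration. The index shift by \<open>m\<close> costs \<open>r ^ m\<close>; the restriction
  \<open>r \<le> 2\<close> makes \<open>C\<close> independent of \<open>r\<close> and
  \<open>K\<close>.\<close>

lemma weight_ge_delta:
  assumes h: "bdd h" "\<And>x. 0 \<le> h x" and x: "x \<in> carrier G" "0 < h x"
  shows "\<exists>C>0. \<forall>r K. 1 < r \<longrightarrow> r \<le> 2 \<longrightarrow> 1 \<le> K \<longrightarrow> C * weight r K (heat 0) \<le> weight r K h"
proof -
  obtain m c where c: "c > 0" and
    H: "\<forall>f y. bdd f \<longrightarrow> (\<forall>z\<in>carrier G. 0 \<le> f z) \<longrightarrow> y \<in> carrier G \<longrightarrow>
      c * f y \<le> (M ^^ m) f (inv x \<otimes> y)"
    using harnack[OF inv_closed[OF x(1)]] by blast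
  have "c * h x \<le> (M ^^ m) h (inv x \<otimes> x)"
    using H h x by blast
  then have one: "c * h x \<le> (M ^^ m) h \<one>"
    using x by simp
  define \<beta> where "\<beta> = c * h x"
  have \<beta>: "0 < \<beta>"
    using c x by (simp add: \<beta>_def)
  have "\<beta> * heat n \<one> \<le> (M ^^ (n + m)) h \<one>" for n
  proof -
    have "\<beta> * heat n \<one> = (M ^^ n) (\<lambda>y. \<beta> * heat 0 y) \<one>"
      unfolding iter_cmult by (simp add: heat_def)
    also have "\<dots> \<le> (M ^^ n) ((M ^^ m) h) \<one>"
    proof (rule iter_mono)
      show "\<beta> * heat 0 y \<le> (M ^^ m) h y" if "y \<in> carrier G" for y
        using one iter_nonneg[of h y m] h(2) that by (cases "y = \<one>") (simp_all add: heat_0 \<beta>_def)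
    qed (simp_all add: bounded_image_cmult heat_bdd iter_bdd h(1))
    finally show ?thesis
      by (simp add: funpow_add)
  qed
  note beta = this
  have "(\<beta> / 2 ^ m) * weight r K (heat 0) \<le> weight r K h" if r: "1 < r" "r \<le> 2" and K: "1 \<le> K" for r K
  proof -
    note su = weight_summable[OF r(1) K]
    have shift: "summable (\<lambda>n. tent r K (n + m) * (M ^^ (n + m)) h \<one>)"
      by (rule summable_ignore_initial_segment[OF su[OF h(1)]])
    have "(\<beta> / 2 ^ m) * weight r K (heat 0) = (\<Sum>n. (\<beta> / 2 ^ m) * (tent r K n * heat n \<one>))"
      using suminf_mult[OF su[OF heat_bdd[of 0]], of "\<beta> / 2 ^ m"] by (simp add: weight_def heat_def)
    also have "\<dots> \<le> (\<Sum>n. tent r K (n + m) * (M ^^ (n + m)) h \<one>)"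
    proof (rule suminf_le)
      show "summable (\<lambda>n. (\<beta> / 2 ^ m) * (tent r K n * heat n \<one>))"
        using summable_mult[OF su[OF heat_bdd[of 0]], of "\<beta> / 2 ^ m"] by (simp add: heat_def)
      fix n
      have "tent r K n \<le> r ^ m * tent r K (n + m)"
        by (rule tent_le_add[OF r(1) K])
      also have "\<dots> \<le> 2 ^ m * tent r K (n + m)"
        using r tent_pos[OF r(1) K, of "n + m"] by (intro mult_right_mono power_mono) simp_all
      finally have t: "tent r K n / 2 ^ m \<le> tent r K (n + m)"
        by (simp add: pos_divide_le_eq mult.commute)
      have "(\<beta> / 2 ^ m) * (tent r K n * heat n \<one>) = (tent r K n / 2 ^ m) * (\<beta> * heat n \<one>)"
        by simp
      also have "\<dots> \<le> tent r K (n + m) * (M ^^ (n + m)) h \<one>"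
        using t beta \<beta> heat_nonneg tent_pos[OF r(1) K, of "n + m"] by (intro mult_mono) simp_all
      finally show "(\<beta> / 2 ^ m) * (tent r K n * heat n \<one>) \<le> tent r K (n + m) * (M ^^ (n + m)) h \<one>" .
    qed (rule shift)
    also have "\<dots> \<le> weight r K h"
    proof -
      have "0 \<le> (\<Sum>n<m. tent r K n * (M ^^ n) h \<one>)"
        using tent_pos[OF r(1) K] h(2)
        by (intro sum_nonneg mult_nonneg_nonneg iter_nonneg) (auto intro: less_imp_le)
      then show ?thesis
        using suminf_split_initial_segment[OF su[OF h(1)], of m] by (simp add: weight_def)
    qed
    finally show ?thesis .
  qed
  moreover have "0 < \<beta> / 2 ^ m"
    using \<beta> by simp
  ultimately show ?thesis
    by blast
qed

lemma weight_delta_unbounded: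
  assumes r: "1 < r" and div: "\<not> summable (\<lambda>n. r ^ n * heat n \<one>)"
  shows "\<exists>K\<ge>1. B \<le> weight r K (heat 0)"
proof -
  have nonneg: "0 \<le> r ^ n * heat n \<one>" for n
    using r heat_nonneg[of n \<one>] by simp
  have "\<exists>N. B \<le> (\<Sum>n<N. r ^ n * heat n \<one>)"
  proof (rule ccontr)
    assume "\<not> ?thesis"
    then have "(\<Sum>n<N. r ^ n * heat n \<one>) \<le> B" for N
      by (meson less_imp_le not_le)
    then have "summable (\<lambda>n. r ^ n * heat n \<one>)"
      by (intro summableI_nonneg_bounded[of _ B] nonneg)
    then show False
      using div by blast
  qed
  then obtain N where N: "B \<le> (\<Sum>n<N. r ^ n * heat n \<one>)"
    by blast
  \<comment> \<open>With this \<open>K\<close> the two branches of the tent meet at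
    \<open>N\<close>, so the first \<open>N\<close> weights are exactly
    \<open>r ^ n\<close>.\<close>
  define K where "K = r ^ N * r ^ N"
  have "1 \<le> r ^ N"
    using r by simp
  then have K: "1 \<le> K"
    using mult_mono[of 1 "r ^ N" 1 "r ^ N"] by (simp add: K_def)
  have tent: "tent r K n = r ^ n" if "n < N" for n
  proof -
    have "r ^ n * r ^ n \<le> K"
      unfolding K_def using r that by (intro mult_mono power_increasing) simp_all
    then show ?thesis
      using r by (simp add: tent_def pos_le_divide_eq min_absorb1)
  qed
  have "(\<Sum>n<N. r ^ n * heat n \<one>) = (\<Sum>n<N. tent r K n * (M ^^ n) (heat 0) \<one>)"
    by (intro sum.cong) (simp_all add: tent heat_def)
  also have "\<dots> \<le> weight r K (heat 0)"
    unfolding weight_def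
  proof (rule sum_le_suminf[OF weight_summable[OF r K heat_bdd]])
    show "0 \<le> tent r K n * (M ^^ n) (heat 0) \<one>" for n
      using tent_pos[OF r K, of n] by (simp add: iter_nonneg heat_nonneg)
  qed simp
  finally show ?thesis
    using N K by (intro exI[of _ K]) simp
qed

text \<open>Ratios of weights are already additive and multiplicative in the required sense for each
  \<open>k\<close>, and the ultralimit preserves this. Stationarity holds only in the limit, as
  \<open>r k\<close> tends to 1 and the weights of nonzero functions tend to infinity.\<close>

lemma green_diverges_imp_stationary:
  assumes div: "\<And>r. 1 < r \<Longrightarrow> \<not> summable (\<lambda>n. r ^ n * heat n \<one>)"
  shows "\<exists>P. conditional_mean G P \<and> stationary G \<mu> P"
proof -
  define r where "r k = 1 + 1 / real (Suc k)" for k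
  have r: "1 < r k" "r k \<le> 2" for k
    by (simp_all add: r_def)
  have "\<exists>K\<ge>1. real (Suc k) \<le> weight (r k) K (heat 0)" for k
    by (rule weight_delta_unbounded[OF r(1) div[OF r(1)]])
  then obtain K where K: "\<And>k. 1 \<le> K k" "\<And>k. real (Suc k) \<le> weight (r k) (K k) (heat 0)"
    by metis
  define W where "W k = weight (r k) (K k)" for k
  have W_add: "W k (\<lambda>x. f x + h x) = W k f + W k h" if "bdd f" "bdd h" for k f h
    unfolding W_def using that by (rule weight_add[OF r(1) K(1)])
  have W_mono: "W k f \<le> W k h" if "bdd f" "bdd h" "\<And>x. f x \<le> h x" for k f h
    unfolding W_def using that by (rule weight_mono[OF r(1) K(1)])
  have W_nonneg: "0 \<le> W k f" if "bdd f" "\<And>x. 0 \<le> f x" for k f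
    unfolding W_def using that by (rule weight_nonneg[OF r(1) K(1)])
  have W_stationary: "W k (M f) \<le> r k * W k f" "W k f \<le> f \<one> + r k * W k (M f)"
    if f: "bdd f" "\<And>x. 0 \<le> f x" for k f
    unfolding W_def by (rule weight_stationary[OF r(1) K(1) f])+
  note K2 = K(2)[folded W_def]
  have cmD: "bdd f" "bdd h" "\<And>x. 0 \<le> f x" "\<And>x. f x \<le> h x" "\<And>x. 0 \<le> h x" "h \<noteq> (\<lambda>_. 0)"
    if "cm_defined G f h" for f h
    using that unfolding cm_defined_def le_fun_def l_infty_def by (auto intro: order_trans)
  \<comment> \<open>This makes every denominator positive and, growing linearly in \<open>k\<close>,
    kills the boundary term of \<open>weight_stationary\<close>.\<close>
  have W_lower: "\<exists>C>0. \<forall>k. C * real (Suc k) \<le> W k h" if d: "cm_defined G f h" for f h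
  proof -
    obtain x where x: "h x \<noteq> 0"
      using cmD(6)[OF d] by blast
    have "x \<in> carrier G"
      using d x unfolding cm_defined_def l_infty_def by blast
    moreover have "0 < h x"
      using x cmD(5)[OF d, of x] by simp
    ultimately obtain C where C: "C > 0"
      "\<forall>r K. 1 < r \<longrightarrow> r \<le> 2 \<longrightarrow> 1 \<le> K \<longrightarrow> C * weight r K (heat 0) \<le> weight r K h"
      using weight_ge_delta[OF cmD(2)[OF d] cmD(5)[OF d]] by blast
    have "C * real (Suc k) \<le> W k h" for k
    proof -
      have "C * real (Suc k) \<le> C * W k (heat 0)"
        using C(1) K2[of k] by (intro mult_left_mono) simp_all
      also have "\<dots> \<le> W k h"
        unfolding W_def using C(2) r K(1) by blast
      finally show ?thesis .
    qed
    then show ?thesis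
      using C(1) by blast
  qed
  have W_pos: "0 < W k h" if d: "cm_defined G f h" for f h k
  proof -
    obtain C where "C > 0" "C * real (Suc k) \<le> W k h"
      using W_lower[OF d] by blast
    moreover have "0 < C * real (Suc k)"
      using \<open>C > 0\<close> by simp
    ultimately show ?thesis
      by linarith
  qed
  obtain L :: "(nat \<Rightarrow> real) \<Rightarrow> real" where L:
    "\<And>x y. Bseq x \<Longrightarrow> Bseq y \<Longrightarrow> L (\<lambda>n. x n + y n) = L x + L y"
    "\<And>x y. Bseq x \<Longrightarrow> Bseq y \<Longrightarrow> L (\<lambda>n. x n * y n) = L x * L y"
    "\<And>x heat. Bseq x \<Longrightarrow> (\<And>n. heat \<le> x n) \<Longrightarrow> heat \<le> L x"
    "\<And>x heat. Bseq x \<Longrightarrow> (\<And>n. x n \<le> heat) \<Longrightarrow> L x \<le> heat"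
    "\<And>x l. x \<longlonglongrightarrow> l \<Longrightarrow> L x = l"
    by (rule ultralimit_exists) blast
  define R where "R f h k = W k f / W k h" for f h k
  define P where "P f h = L (R f h)" for f h
  have R_nonneg: "0 \<le> R f h k" and R_le: "R f h k \<le> 1" if d: "cm_defined G f h" for f h k
    using W_nonneg[OF cmD(1,3)[OF d], of k] W_mono[OF cmD(1,2,4)[OF d], of k] W_pos[OF d, of k]
    by (simp_all add: R_def)
  have R_Bseq: "Bseq (R f h)" if d: "cm_defined G f h" for f h
  proof (rule BseqI')
    show "norm (R f h k) \<le> 1" for k
      using R_nonneg[OF d] R_le[OF d] by simp
  qed
  have "conditional_mean G P"
    unfolding conditional_mean_def
  proof (intro conjI allI impI)
    fix f h assume d: "cm_defined G f h"
    show "P f h \<in> {0..1}"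
      unfolding P_def atLeastAtMost_iff
      by (intro conjI L(3,4) R_Bseq[OF d] R_nonneg[OF d] R_le[OF d])
  next
    fix f\<^sub>1 f\<^sub>2 h
    assume d: "cm_defined G f\<^sub>1 h \<and> cm_defined G f\<^sub>2 h \<and> cm_defined G (\<lambda>x. f\<^sub>1 x + f\<^sub>2 x) h"
    then have d1: "cm_defined G f\<^sub>1 h" and d2: "cm_defined G f\<^sub>2 h"
      by blast+
    have "R (\<lambda>x. f\<^sub>1 x + f\<^sub>2 x) h = (\<lambda>k. R f\<^sub>1 h k + R f\<^sub>2 h k)"
      unfolding R_def W_add[OF cmD(1)[OF d1] cmD(1)[OF d2]] add_divide_distrib ..
    then show "P (\<lambda>x. f\<^sub>1 x + f\<^sub>2 x) h = P f\<^sub>1 h + P f\<^sub>2 h"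
      unfolding P_def using L(1)[OF R_Bseq[OF d1] R_Bseq[OF d2]] by simp
  next
    fix f\<^sub>1 f\<^sub>2 h
    assume d: "cm_defined G f\<^sub>1 h \<and> cm_defined G f\<^sub>1 f\<^sub>2 \<and> cm_defined G f\<^sub>2 h"
    then have d1: "cm_defined G f\<^sub>1 f\<^sub>2" and d2: "cm_defined G f\<^sub>2 h"
      by blast+
    \<comment> \<open>The quotients telescope because the weight of \<open>f\<^sub>2\<close> is
      nonzero.\<close>
    have "R f\<^sub>1 h k = R f\<^sub>1 f\<^sub>2 k * R f\<^sub>2 h k" for k
      using W_pos[OF d1, of k] by (simp add: R_def)
    then have "R f\<^sub>1 h = (\<lambda>k. R f\<^sub>1 f\<^sub>2 k * R f\<^sub>2 h k)"
      by blast
    then show "P f\<^sub>1 h = P f\<^sub>1 f\<^sub>2 * P f\<^sub>2 h"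
      unfolding P_def using L(2)[OF R_Bseq[OF d1] R_Bseq[OF d2]] by simp
  next
    fix f assume d: "cm_defined G f f"
    have "R f f k = 1" for k
      using W_pos[OF d, of k] by (simp add: R_def)
    then have "R f f = (\<lambda>_. 1)"
      by blast
    then show "P f f = 1"
      unfolding P_def using L(5)[OF tendsto_const] by simp
  qed
  moreover have "stationary G \<mu> P"
    unfolding stationary_def
  proof (intro allI impI)
    fix f h assume d: "cm_defined G f h \<and> cm_defined G (M f) h"
    then have d1: "cm_defined G f h" and d2: "cm_defined G (M f) h"
      by blast+
    obtain C where C: "C > 0" "\<forall>k. C * real (Suc k) \<le> W k h"
      using W_lower[OF d1] by blast
    define e where "e k = R (M f) h k - R f h k" for k
    \<comment> \<open>The factor \<open>r k\<close> contributes the relative error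
      \<open>1 / real (Suc k)\<close>. The boundary term contributes at most
      \<open>h \<one> / W k h\<close>, which the linear lower bound turns into
      \<open>h \<one> / (C * real (Suc k))\<close>.\<close>
    have e_le: "norm (e k) \<le> (1 + h \<one> / C) * (1 / real (Suc k))" for k
    proof -
      have r1: "r k = 1 + 1 / real (Suc k)"
        by (simp add: r_def)
      have f_le: "W k f \<le> W k h"
        by (rule W_mono[OF cmD(1,2,4)[OF d1]])
      have Mf_le: "W k (M f) \<le> W k h"
        by (rule W_mono[OF cmD(1,2,4)[OF d2]])
      have "W k (M f) - W k f \<le> 1 / real (Suc k) * W k f"
        using W_stationary(1)[OF cmD(1,3)[OF d1], of k] by (simp add: r1 distrib_right)
      also have "\<dots> \<le> 1 / real (Suc k) * W k h"
        using f_le by (intro mult_left_mono) simp_all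
      finally have up: "W k (M f) - W k f \<le> 1 / real (Suc k) * W k h" .
      have "W k f - W k (M f) \<le> f \<one> + 1 / real (Suc k) * W k (M f)"
        using W_stationary(2)[OF cmD(1,3)[OF d1], of k] by (simp add: r1 distrib_right)
      also have "\<dots> \<le> h \<one> + 1 / real (Suc k) * W k h"
        using Mf_le cmD(4)[OF d1, of \<one>] by (intro add_mono mult_left_mono) simp_all
      finally have "\<bar>W k (M f) - W k f\<bar> \<le> h \<one> + 1 / real (Suc k) * W k h"
        using up cmD(5)[OF d1, of \<one>] by linarith
      then have "\<bar>W k (M f) - W k f\<bar> / W k h \<le> (h \<one> + 1 / real (Suc k) * W k h) / W k h"
        using W_pos[OF d1, of k] by (intro divide_right_mono) simp_all
      also have "\<dots> = h \<one> / W k h + 1 / real (Suc k)"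
        using W_pos[OF d1, of k] by (simp add: add_divide_distrib)
      also have "\<dots> \<le> h \<one> / (C * real (Suc k)) + 1 / real (Suc k)"
        using C cmD(5)[OF d1, of \<one>] W_pos[OF d1, of k]
        by (intro add_right_mono divide_left_mono) simp_all
      also have "\<dots> = (1 + h \<one> / C) * (1 / real (Suc k))"
        by (simp add: add_divide_distrib del: of_nat_Suc)
      finally show ?thesis
        using W_pos[OF d1, of k] by (simp add: e_def R_def diff_divide_distrib[symmetric])
    qed
    have "(\<lambda>k. (1 + h \<one> / C) * (1 / real (Suc k))) \<longlonglongrightarrow> 0"
      using tendsto_mult_right_zero[OF LIMSEQ_inverse_real_of_nat] by (simp add: divide_inverse)
    moreover have "eventually (\<lambda>k. norm (e k) \<le> (1 + h \<one> / C) * (1 / real (Suc k))) sequentially"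
      using e_le by (intro always_eventually allI)
    ultimately have e: "e \<longlonglongrightarrow> 0"
      by (rule Lim_null_comparison[rotated])
    have "Bseq e"
      by (rule convergent_imp_Bseq[OF convergentI[OF e]])
    have "R (M f) h = (\<lambda>k. R f h k + e k)"
      by (simp add: e_def)
    then have "P (M f) h = P f h + L e"
      unfolding P_def using L(1)[OF R_Bseq[OF d1] \<open>Bseq e\<close>] by simp
    then show "P (M f) h = P f h"
      unfolding L(5)[OF e] by simp
  qed
  ultimately show ?thesis
    by blast
qed

end

theorem theorem3:
  fixes G :: "('a, 'b) monoid_scheme" and \<mu> :: "'a pmf"
  assumes "group G"
    and "set_pmf \<mu> \<subseteq> carrier G"
    and "symmetric_pmf G \<mu>"
    and "nondegenerate_pmf G \<mu>"
  shows "(\<exists>P. conditional_mean G P \<and> stationary G \<mu> P) \<longleftrightarrow> amenable G"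
proof -
  interpret group G by fact
  interpret symmetric_walk G \<mu>
  proof
    show "pmf \<mu> (inv\<^bsub>G\<^esub> g) = pmf \<mu> g" if "g \<in> carrier G" for g
      using assms(3) that unfolding symmetric_pmf_def by metis
  qed (use assms in \<open>auto simp: nondegenerate_pmf_def\<close>)
  show ?thesis
  proof
    assume "\<exists>P. conditional_mean G P \<and> stationary G \<mu> P"
    then obtain P where P: "conditional_mean G P" "stationary G \<mu> P"
      by blast
    show "amenable G"
      by (rule slow_decay_imp_amenable[OF stationary_imp_slow_decay[OF P]])
  next
    assume "amenable G"
    then show "\<exists>P. conditional_mean G P \<and> stationary G \<mu> P"
      by (intro green_diverges_imp_stationary amenable_imp_green_diverges)
  qed
qed

end
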